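(* Let $h\in\Sigma^\alpha[1]$, $\alpha\in[0,2]$, and let $S=\{F_t\}_{t\ge0}$ be defined by $F_t(z)=h^{-1}(h(z)+t)$, $z\in\Delta$, $t\ge0$. The following two assertions hold. (A) Assume that for some $z\in\Delta$, the trajectory $\{F_t(z)\}_{t\ge0}$ converges to $z=1$ strongly tangentially. Then (i) $\alpha=1$; (ii) $h(\Delta)$ is contained in a horizontal half-plane. (B) Conversely, assume that conditions (i) and (ii) are fulfilled. Then all the trajectories $\{F_t(z)\}_{t\ge0}$, $z\in\Delta$, converge to $z=1$ strongly tangentially. Moreover, in this case $$\mu=\lim_{z\to1,\,z\in\Delta}(1-z)^2h'(z)$$ is purely imaginary, and either $$\operatorname{Im}h(z)\ge\frac{-\operatorname{Im}\mu}{2\varepsilon(0)},\quad z\in\Delta,\qquad\text{if }\operatorname{Im}\mu>0,$$ or $$\operatorname{Im}h(z)\le\frac{-\operatorname{Im}\mu}{2\varepsilon(0)},\quad z\in\Delta,\qquad\text{if }\operatorname{Im}\mu<0.$$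
   Context: $\Delta$ is the open unit disk in $\mathbb{C}$. $\Sigma[1]$ is the class of univalent holomorphic functions $h:\Delta\to\mathbb{C}$ such that $h(0)=0$, $h(z)+t\in h(\Delta)$ for all $z\in\Delta$, $t\ge0$, and $\lim_{t\to\infty}h^{-1}(h(z)+t)=1$ for all $z\in\Delta$. For $\alpha\ge0$, $\Sigma^\alpha[1]$ is the class of those $h\in\Sigma[1]$ for which the unrestricted limit $\lim_{z\to1,\,z\in\Delta}(1-z)^{1+\alpha}h'(z)$ exists, is finite and is different from zero (principal branch of the power). For $z\in\Delta$ put $d(z)=\frac{|1-z|^2}{1-|z|^2}$. For every $z\in\Delta$ the function $t\mapsto d(F_t(z))$ is decreasing (non-increasing), so $\varepsilon(z):=\lim_{t\to\infty}d(F_t(z))\ge0$ exists. The trajectory $\{F_t(z)\}_{t\ge0}$ is said to converge to $1$ strongly tangentially if $\varepsilon(z)>0$. A horizontal half-plane is a half-plane whose boundary is parallel to the real axis. *)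

theory Defs
  imports "HOL-Complex_Analysis.Complex_Analysis"
begin

abbreviation unit_disk :: "complex set" where
  "unit_disk \<equiv> ball 0 1"

definition semiflow :: "(complex \<Rightarrow> complex) \<Rightarrow> real \<Rightarrow> complex \<Rightarrow> complex" where
  "semiflow h t z = inv_into unit_disk h (h z + complex_of_real t)"

definition Sigma1 :: "(complex \<Rightarrow> complex) set" where
  "Sigma1 = {h. h holomorphic_on unit_disk \<and> inj_on h unit_disk \<and> h 0 = 0 \<and>
     (\<forall>z\<in>unit_disk. \<forall>t\<ge>0. h z + complex_of_real t \<in> h ` unit_disk) \<and>
     (\<forall>z\<in>unit_disk. ((\<lambda>t. semiflow h t z) \<longlongrightarrow> 1) at_top)}"

definition Sigma1_pow :: "real \<Rightarrow> (complex \<Rightarrow> complex) set" where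
  "Sigma1_pow \<alpha> = {h \<in> Sigma1. \<exists>l. l \<noteq> 0 \<and>
     ((\<lambda>z. (1 - z) powr complex_of_real (1 + \<alpha>) * deriv h z) \<longlongrightarrow> l) (at 1 within unit_disk)}"

definition horo_dist :: "complex \<Rightarrow> real" where
  "horo_dist z = (cmod (1 - z))\<^sup>2 / (1 - (cmod z)\<^sup>2)"

definition orbit_eps :: "(complex \<Rightarrow> complex) \<Rightarrow> complex \<Rightarrow> real" where
  "orbit_eps h z = Lim at_top (\<lambda>t. horo_dist (semiflow h t z))"

(* Requiring the limit to exist keeps an unspecified value of Lim from counting as positive. *)
definition strongly_tangential :: "(complex \<Rightarrow> complex) \<Rightarrow> complex \<Rightarrow> bool" where
  "strongly_tangential h z \<longleftrightarrow>
     ((\<lambda>t. semiflow h t z) \<longlongrightarrow> 1) at_top \<and>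
     ((\<lambda>t. horo_dist (semiflow h t z)) \<longlongrightarrow> orbit_eps h z) at_top \<and> orbit_eps h z > 0"

(* Open and closed half-planes are both allowed. *)
definition horizontal_half_plane :: "complex set \<Rightarrow> bool" where
  "horizontal_half_plane H \<longleftrightarrow>
     (\<exists>c. H = {w. Im w > c} \<or> H = {w. Im w \<ge> c} \<or> H = {w. Im w < c} \<or> H = {w. Im w \<le> c})"

end

theory Submission
  imports Defs
begin

text \<open>The Cayley transform \<open>w = (1 + z) / (1 - z)\<close> carries the disk to the right half-plane and
  \<open>horo_dist z\<close> to \<open>1 / Re w\<close>. Put \<open>g w = h z\<close>; its trajectories satisfy
  \<open>g (w\<^sub>t) = g w + t\<close>, and the growth condition becomes
  \<open>g' w * ((w + 1) / 2) powr (1 - \<alpha>) \<rightarrow> c\<close>. By Julia's lemma \<open>Re w\<^sub>t\<close> increases, so strong tangential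
  convergence means that \<open>Re w\<^sub>t\<close> is bounded.

  If \<open>Re w\<^sub>t\<close> is bounded, then the Schwarz--Pick inequality keeps \<open>g' (w\<^sub>t)\<close> away from \<open>0\<close>, so
  \<open>\<alpha> \<ge> 1\<close>; and \<open>\<alpha> > 1\<close> would make \<open>w\<^sub>t\<^sup>\<alpha> / t \<rightarrow> const / c\<close> have negative real part, against \<open>Re g' \<ge> 0\<close>.
  If \<open>\<alpha> = 1\<close>, then \<open>g' \<rightarrow> c\<close> gives \<open>w\<^sub>t - v\<^sub>t \<rightarrow> (g w - g v) / c\<close>. Boundedness of one \<open>Re w\<^sub>t\<close> forces
  \<open>Re c = 0\<close>, and comparing the limits of \<open>Re w\<^sub>t\<close> and \<open>Re v\<^sub>t > 0\<close> bounds \<open>Im g\<close> on one side.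
  Conversely, if \<open>Im g\<close> is bounded on one side, then
  \<open>G = - \<i> \<sigma> g + const\<close>, with \<open>\<sigma> = 1\<close> or
  \<open>\<sigma> = -1\<close>, maps the half-plane to itself and \<open>G' \<rightarrow> \<beta>\<close> at infinity. Hence \<open>\<beta> > 0\<close> and
  \<open>\<beta> Re w \<le> Re (G w)\<close>, where the right side is constant along trajectories.\<close>

subsection \<open>The Schwarz--Pick inequality on the right half-plane\<close>

abbreviation right_half_plane :: "complex set" where
  "right_half_plane \<equiv> {w. Re w > 0}"

text \<open>The quotient |w - v| / |w + cnj v| is the pseudo-hyperbolic distance of the right
  half-plane. This identity shows it to be below 1 and trades the Schwarz-Pick inequality for one in
  real parts.\<close>

lemma cmod_add_cnj_squared: "(cmod (w + cnj v))\<^sup>2 = (cmod (w - v))\<^sup>2 + 4 * Re w * Re v"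
  unfolding cmod_power2 by (simp add: power2_eq_square algebra_simps)

lemma add_cnj_nonzero: "Re w > 0 \<Longrightarrow> Re v > 0 \<Longrightarrow> w + cnj v \<noteq> 0"
  by (auto simp: complex_eq_iff)

text \<open>Moving \<open>v\<close> and \<open>F v\<close> to the centre of the disk reduces the
  claim to the Schwarz lemma: \<open>F\<close> does not increase pseudo-hyperbolic distance. The
  form without quotients is convenient for passing to limits.\<close>

lemma Schwarz_Pick_half_plane:
  assumes hol: "F holomorphic_on right_half_plane"
    and im: "\<And>w. Re w > 0 \<Longrightarrow> Re (F w) > 0"
    and w: "Re w > 0" and v: "Re v > 0"
  shows "cmod (F w - F v) * cmod (w + cnj v) \<le> cmod (w - v) * cmod (F w + cnj (F v))"
proof -
  \<comment> \<open>\<open>\<phi> b\<close> maps the half-plane into the disk and sends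
    \<open>b\<close> to 0; \<open>\<psi>\<close> is the inverse of \<open>\<phi> v\<close>, so it
    sends 0 to \<open>v\<close>.\<close>
  define \<psi> where "\<psi> = (\<lambda>z. (v + cnj v * z) / (1 - z))"
  define \<phi> where "\<phi> = (\<lambda>b w. (w - b) / (w + cnj b))"
  have \<psi>_pos: "Re (\<psi> z) > 0" if "cmod z < 1" for z
  proof -
    have "(cmod z)\<^sup>2 < 1" using that by (simp add: abs_square_less_1)
    moreover have "1 - z \<noteq> 0" using that by auto
    moreover have "Re (\<psi> z) = Re v * (1 - (cmod z)\<^sup>2) / (cmod (1 - z))\<^sup>2"
      unfolding \<psi>_def Re_divide cmod_power2
      by (simp add: power2_eq_square algebra_simps)
    ultimately show ?thesis using v by (auto intro!: divide_pos_pos)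
  qed
  have \<phi>_lt: "cmod (\<phi> b u) < 1" if "Re b > 0" "Re u > 0" for b u
  proof -
    have "(cmod (u - b))\<^sup>2 < (cmod (u + cnj b))\<^sup>2"
      unfolding cmod_add_cnj_squared using that by simp
    then have "cmod (u - b) < cmod (u + cnj b)"
      by (rule power_less_imp_less_base) auto
    then show ?thesis
      unfolding \<phi>_def norm_divide by (subst divide_less_eq_1) auto
  qed
  define f where "f = \<phi> (F v) \<circ> F \<circ> \<psi>"
  have "f holomorphic_on ball 0 1"
    unfolding f_def
  proof (intro holomorphic_on_compose_gen[where t = right_half_plane])
    show "\<psi> holomorphic_on ball 0 1"
      unfolding \<psi>_def by (intro holomorphic_intros) auto
    show "F holomorphic_on right_half_plane" by (rule hol)
    show "\<phi> (F v) holomorphic_on right_half_plane"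
      unfolding \<phi>_def using add_cnj_nonzero im v by (intro holomorphic_intros) auto
  qed (use \<psi>_pos im in auto)
  moreover have "f 0 = 0" by (simp add: f_def \<psi>_def \<phi>_def)
  moreover have "cmod (f z) < 1" if "cmod z < 1" for z
    using \<phi>_lt[OF im[OF v] im[OF \<psi>_pos[OF that]]] by (simp add: f_def)
  ultimately have "cmod (f (\<phi> v w)) \<le> cmod (\<phi> v w)"
    using Schwarz_Lemma(1) \<phi>_lt v w by blast
  moreover have nz: "w + cnj v \<noteq> 0" "F w + cnj (F v) \<noteq> 0"
    using add_cnj_nonzero im v w by auto
  moreover have "\<psi> (\<phi> v w) = w"
  proof -
    have "v + cnj v \<noteq> 0" using v add_cnj_nonzero by blast
    have "v + cnj v * \<phi> v w = w * (v + cnj v) / (w + cnj v)"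
      "1 - \<phi> v w = (v + cnj v) / (w + cnj v)"
      using nz by (simp_all add: \<phi>_def field_simps)
    then show ?thesis unfolding \<psi>_def using nz \<open>v + cnj v \<noteq> 0\<close> by simp
  qed
  ultimately show ?thesis
    by (simp add: f_def \<phi>_def norm_divide field_simps)
qed

text \<open>After squaring, the common term |F w - F v|^2 |w - v|^2 cancels. This form remains
  informative when one of the points escapes to infinity.\<close>

lemma Schwarz_Pick_half_plane_Re:
  assumes hol: "F holomorphic_on right_half_plane"
    and im: "\<And>w. Re w > 0 \<Longrightarrow> Re (F w) > 0"
    and w: "Re w > 0" and v: "Re v > 0"
  shows "Re w * Re v * (cmod (F w + cnj (F v)))\<^sup>2 \<le> Re (F w) * Re (F v) * (cmod (w + cnj v))\<^sup>2"
proof -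
  have "(cmod (F w - F v))\<^sup>2 * (cmod (w + cnj v))\<^sup>2 \<le> (cmod (w - v))\<^sup>2 * (cmod (F w + cnj (F v)))\<^sup>2"
    using power_mono[OF Schwarz_Pick_half_plane[OF assms], of 2] by (simp add: power_mult_distrib)
  then show ?thesis
    by (simp add: cmod_add_cnj_squared algebra_simps)
qed

text \<open>Divide the two-point inequality by |w - v| and let \<open>w\<close> tend to
  \<open>v\<close>; the remaining sums become 2 Re v and 2 Re (F v).\<close>

lemma Schwarz_Pick_half_plane_deriv:
  assumes hol: "F holomorphic_on right_half_plane"
    and im: "\<And>w. Re w > 0 \<Longrightarrow> Re (F w) > 0" and v: "Re v > 0"
  shows "cmod (deriv F v) * Re v \<le> Re (F v)"
proof -
  have op: "open right_half_plane" by (rule open_halfspace_Re_gt)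
  then have "(F has_field_derivative deriv F v) (at v)"
    using hol v by (auto intro: holomorphic_derivI)
  then have lim: "((\<lambda>w. (F w - F v) / (w - v)) \<longlongrightarrow> deriv F v) (at v)"
    by (simp add: has_field_derivative_iff)
  have cont: "(F \<longlongrightarrow> F v) (at v)"
    using \<open>(F has_field_derivative deriv F v) (at v)\<close> DERIV_isCont isCont_def by blast
  have "cmod (deriv F v) * cmod (v + cnj v) \<le> cmod (F v + cnj (F v))"
  proof (rule tendsto_le)
    show "\<forall>\<^sub>F w in at v. cmod ((F w - F v) / (w - v)) * cmod (w + cnj v) \<le> cmod (F w + cnj (F v))"
    proof -
      have "\<forall>\<^sub>F w in at v. w \<in> right_half_plane - {v}"
        by (rule eventually_at_in_open[OF op]) (use v in simp)
      then show ?thesis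
      proof eventually_elim
        case (elim w)
        then show ?case
          using Schwarz_Pick_half_plane[OF hol im, of w v] v
          by (simp add: norm_divide field_simps)
      qed
    qed
    show "((\<lambda>w. cmod ((F w - F v) / (w - v)) * cmod (w + cnj v)) \<longlongrightarrow>
        cmod (deriv F v) * cmod (v + cnj v)) (at v)"
      by (intro tendsto_intros lim)
    show "((\<lambda>w. cmod (F w + cnj (F v))) \<longlongrightarrow> cmod (F v + cnj (F v))) (at v)"
      by (intro tendsto_intros cont)
  qed simp
  then show ?thesis
    using v im[OF v] by (simp add: complex_add_cnj norm_mult)
qed

text \<open>L'Hospital's rule with denominator t, applied to real and imaginary parts. It turns a
  limiting velocity into an asymptotic direction, along rays as well as along trajectories.\<close>

lemma vector_derivative_limit_imp_ratio_limit:
  fixes f :: "real \<Rightarrow> complex"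
  assumes der: "\<And>t. t \<ge> 0 \<Longrightarrow> (f has_vector_derivative f' t) (at t)"
    and lim: "(f' \<longlongrightarrow> L) at_top"
  shows "((\<lambda>t. f t / of_real t) \<longlongrightarrow> L) at_top"
proof -
  have ratio: "((\<lambda>t. u t / t) \<longlongrightarrow> y) at_top"
    if u: "\<And>t. t \<ge> 0 \<Longrightarrow> (u has_real_derivative u' t) (at t)" and y: "(u' \<longlongrightarrow> y) at_top"
    for u u' :: "real \<Rightarrow> real" and y
  proof (rule lhospital_at_top_at_top[of "\<lambda>x. x" "\<lambda>_. 1"])
    show "\<forall>\<^sub>F x in at_top. (u has_real_derivative u' x) (at x)"
      using eventually_ge_at_top[of 0] by eventually_elim (use u in auto)
    show "((\<lambda>x. u' x / 1) \<longlongrightarrow> y) at_top" using y by simp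
  qed (auto intro: filterlim_ident)
  have "((\<lambda>t. Re (f t) / t) \<longlongrightarrow> Re L) at_top"
    by (rule ratio[where u' = "\<lambda>t. Re (f' t)"])
      (use der lim in \<open>auto intro: tendsto_Re simp: has_vector_derivative_complex_iff\<close>)
  moreover have "((\<lambda>t. Im (f t) / t) \<longlongrightarrow> Im L) at_top"
    by (rule ratio[where u' = "\<lambda>t. Im (f' t)"])
      (use der lim in \<open>auto intro: tendsto_Im simp: has_vector_derivative_complex_iff\<close>)
  ultimately show ?thesis
    by (simp add: tendsto_complex_iff)
qed

subsection \<open>Boundary behaviour at infinity\<close>

text \<open>The counterpart of unrestricted approach to 1 in the disk: the argument may come
  arbitrarily close to that of the imaginary axis.\<close>

definition half_plane_infinity :: "complex filter" where
  "half_plane_infinity = inf at_infinity (principal right_half_plane)"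

lemma filterlim_half_plane_infinity:
  assumes "filterlim f at_infinity F" and "\<forall>\<^sub>F x in F. Re (f x) > 0"
  shows "filterlim f half_plane_infinity F"
  using assms by (simp add: half_plane_infinity_def filterlim_inf filterlim_principal)

lemma tendsto_half_plane_infinityD:
  assumes "(f \<longlongrightarrow> L) half_plane_infinity" and "e > 0"
  obtains R where "\<And>w. cmod w \<ge> R \<Longrightarrow> Re w > 0 \<Longrightarrow> dist (f w) L < e"
  using tendstoD[OF assms]
  by (auto simp: half_plane_infinity_def eventually_inf_principal eventually_at_infinity)

text \<open>Otherwise \<open>q\<close> would eventually increase and stay above a positive value. In
  Julia's lemma this selects the indices at which the orbit does not recede from the
  boundary.\<close>

lemma exists_frequently_decreasing:
  fixes q :: "nat \<Rightarrow> real"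
  assumes pos: "\<And>n. q n > 0" and lim: "q \<longlonglongrightarrow> 0"
  shows "\<exists>\<^sub>F n in sequentially. q (Suc n) \<le> q n"
proof (rule ccontr)
  assume "\<not> (\<exists>\<^sub>F n in sequentially. q (Suc n) \<le> q n)"
  then obtain N where N: "\<And>n. n \<ge> N \<Longrightarrow> q n < q (Suc n)"
    by (auto simp: not_frequently eventually_sequentially not_le)
  have "q N \<le> q (n + N)" for n
  proof (induction n)
    case (Suc n)
    then show ?case using N[of "n + N"] by simp
  qed simp
  moreover have "(\<lambda>n. q (n + N)) \<longlonglongrightarrow> 0"
    using lim by (rule LIMSEQ_ignore_initial_segment)
  ultimately have "q N \<le> 0"
    by (intro LIMSEQ_le_const) auto
  then show False using pos[of N] by simp
qed

lemma cmod_ratio_at_infinity: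
  assumes "filterlim u at_infinity F"
  shows "((\<lambda>x. cmod (u x + 1) / cmod (a + cnj (u x))) \<longlongrightarrow> 1) F"
proof -
  have inv: "((\<lambda>x. inverse (u x)) \<longlongrightarrow> 0) F"
    using assms by (rule filterlim_compose[OF tendsto_inverse_0])
  have "((\<lambda>x. cmod (1 + inverse (u x)) / cmod (1 + cnj a * inverse (u x))) \<longlongrightarrow> cmod (1 + 0) / cmod (1 + cnj a * 0)) F"
    by (intro tendsto_intros inv) auto
  moreover have "\<forall>\<^sub>F x in F. u x \<noteq> 0"
    using assms by (rule filterlim_at_infinity_imp_eventually_ne)
  then have "\<forall>\<^sub>F x in F. cmod (1 + inverse (u x)) / cmod (1 + cnj a * inverse (u x))
      = cmod (u x + 1) / cmod (a + cnj (u x))"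
  proof eventually_elim
    case (elim x)
    \<comment> \<open>Conjugation moves the bar from \<open>u x\<close> to \<open>a\<close>, so that
      \<open>u x\<close> can be factored out of numerator and denominator alike.\<close>
    have "cmod (a + cnj (u x)) = cmod (cnj (a + cnj (u x)))"
      by (simp only: complex_mod_cnj)
    also have "cnj (a + cnj (u x)) = u x * (1 + cnj a * inverse (u x))"
      using elim by (simp add: field_simps)
    finally have "cmod (a + cnj (u x)) = cmod (u x) * cmod (1 + cnj a * inverse (u x))"
      by (simp add: norm_mult)
    moreover have "u x + 1 = u x * (1 + inverse (u x))"
      using elim by (simp add: field_simps)
    then have "cmod (u x + 1) = cmod (u x) * cmod (1 + inverse (u x))"
      by (simp only: norm_mult)
    ultimately show ?case using elim by simp
  qed
  ultimately show ?thesis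
    by (simp add: tendsto_cong)
qed

text \<open>Schwarz-Pick is applied to \<open>w\<close> and an orbit point, which is then sent to
  infinity. Since the image of an orbit point is the next orbit point, a comparison of boundary
  distances along the orbit bounds the dilation at infinity.\<close>

lemma Julia_half_plane:
  assumes hol: "F holomorphic_on right_half_plane"
    and im: "\<And>w. Re w > 0 \<Longrightarrow> Re (F w) > 0"
    and orbit: "filterlim (\<lambda>n. (F ^^ n) v) at_infinity sequentially"
    and v: "Re v > 0" and w: "Re w > 0"
  shows "Re w \<le> Re (F w)"
proof (rule ccontr)
  assume "\<not> Re w \<le> Re (F w)"
  define u where "u n = (F ^^ n) v" for n
  have u_Suc: "u (Suc n) = F (u n)" for n by (simp add: u_def)
  have u_pos: "Re (u n) > 0" for n
    by (induction n) (auto simp: u_Suc im, simp add: u_def v)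
  have u_inf: "filterlim u at_infinity sequentially"
    using orbit by (simp add: u_def[abs_def])
  then have u_Suc_inf: "filterlim (\<lambda>n. u (Suc n)) at_infinity sequentially"
    by (rule filterlim_compose[OF _ filterlim_Suc])
  have nz: "u n + 1 \<noteq> 0" for n using u_pos[of n] by (auto simp: complex_eq_iff)
  \<comment> \<open>This is a quarter of 1 - |z|^2 at the disk point z = (u n - 1) / (u n +
    1).\<close>
  define q where "q n = Re (u n) / (cmod (u n + 1))\<^sup>2" for n
  have q_pos: "q n > 0" for n
    using u_pos nz by (simp add: q_def)
  have "q \<longlonglongrightarrow> 0"
  proof (rule Lim_null_comparison)
    have "q n \<le> inverse (cmod (u n + 1))" for n
    proof -
      have "Re (u n) \<le> cmod (u n + 1)"
        using complex_Re_le_cmod[of "u n + 1"] by simp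
      then show ?thesis using nz[of n]
        by (simp add: q_def power2_eq_square field_simps)
    qed
    then show "\<forall>\<^sub>F n in sequentially. norm (q n) \<le> inverse (cmod (u n + 1))"
      using q_pos by (simp add: less_imp_le)
    have "filterlim (\<lambda>n. u n + 1) at_infinity sequentially"
      by (rule tendsto_add_filterlim_at_infinity'[OF u_inf tendsto_const])
    then have "(\<lambda>n. inverse (u n + 1)) \<longlonglongrightarrow> 0"
      by (rule filterlim_compose[OF tendsto_inverse_0])
    then show "(\<lambda>n. inverse (cmod (u n + 1))) \<longlonglongrightarrow> 0"
      using tendsto_norm_zero by (fastforce simp: norm_inverse)
  qed
  with q_pos have freq: "\<exists>\<^sub>F n in sequentially. q (Suc n) \<le> q n"
    by (rule exists_frequently_decreasing)
  \<comment> \<open>With the weights \<open>q\<close> split off, Schwarz-Pick reads q n * B n <= q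
    (Suc n) * A n, while \<open>A\<close> and \<open>B\<close> tend to Re (F w) and Re w.\<close>
  define A where "A n = Re (F w) * (cmod (u (Suc n) + 1) / cmod (F w + cnj (u (Suc n))))\<^sup>2" for n
  define B where "B n = Re w * (cmod (u n + 1) / cmod (w + cnj (u n)))\<^sup>2" for n
  have "B n \<le> A n" if "q (Suc n) \<le> q n" for n
  proof -
    have pos: "cmod (F w + cnj (u (Suc n))) > 0" "cmod (w + cnj (u n)) > 0"
      "cmod (u n + 1) > 0" "cmod (u (Suc n) + 1) > 0"
      using add_cnj_nonzero[OF im[OF w] u_pos] add_cnj_nonzero[OF w u_pos] nz by auto
    have "Re w * Re (u n) * (cmod (F w + cnj (u (Suc n))))\<^sup>2
        \<le> Re (F w) * Re (u (Suc n)) * (cmod (w + cnj (u n)))\<^sup>2"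
      using Schwarz_Pick_half_plane_Re[OF hol im w u_pos] by (simp add: u_Suc)
    moreover have "Re (u n) = q n * (cmod (u n + 1))\<^sup>2" for n
      using nz by (simp add: q_def)
    ultimately have "q n * B n \<le> q (Suc n) * A n"
      using pos by (simp add: A_def B_def field_simps power_divide)
    also have "\<dots> \<le> q n * A n"
      using that im[OF w] by (intro mult_right_mono) (auto simp: A_def)
    finally show ?thesis using q_pos[of n] by simp
  qed
  then have "\<exists>\<^sub>F n in sequentially. B n \<le> A n"
    using freq by (auto elim: frequently_elim1)
  moreover have "A \<longlonglongrightarrow> Re (F w) * 1\<^sup>2" "B \<longlonglongrightarrow> Re w * 1\<^sup>2"
    unfolding A_def[abs_def] B_def[abs_def]
    by (intro tendsto_intros cmod_ratio_at_infinity u_inf u_Suc_inf)+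
  then have "(\<lambda>n. B n - A n) \<longlonglongrightarrow> Re w - Re (F w)"
    by (intro tendsto_diff) auto
  then have "\<forall>\<^sub>F n in sequentially. B n - A n > 0"
    using \<open>\<not> Re w \<le> Re (F w)\<close> by (intro order_tendstoD) auto
  ultimately show False
    by (simp add: frequently_def not_le)
qed

text \<open>If \<open>G\<close> maps the half-plane into itself, so do its blow-downs along
  rays, which pins down the argument of the derivative at infinity.\<close>

lemma derivative_at_infinity_pos:
  assumes hol: "G holomorphic_on right_half_plane"
    and im: "\<And>w. Re w > 0 \<Longrightarrow> Re (G w) > 0"
    and lim: "(deriv G \<longlongrightarrow> \<beta>) half_plane_infinity"
    and w: "Re w > 0"
  shows "Im \<beta> = 0" and "Re \<beta> \<ge> 0" and "Re \<beta> * Re w \<le> Re (G w)"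
proof -
  have ray: "((\<lambda>r. G (1 + of_real r * a) / of_real r) \<longlongrightarrow> a * \<beta>) at_top"
    if a: "Re a \<ge> 0" "cmod a = 1" for a
  proof (rule vector_derivative_limit_imp_ratio_limit)
    have pos: "Re (1 + of_real r * a) > 0" if "r \<ge> 0" for r
      using mult_nonneg_nonneg[OF that a(1)] by simp
    show "((\<lambda>r. G (1 + of_real r * a)) has_vector_derivative a * deriv G (1 + of_real r * a)) (at r)"
      if "r \<ge> 0" for r
    proof -
      have "((\<lambda>r. 1 + of_real r * a) has_vector_derivative a) (at r)"
        by (auto intro!: derivative_eq_intros simp: has_vector_derivative_def scaleR_conv_of_real)
      moreover have "(G has_field_derivative deriv G (1 + of_real r * a)) (at (1 + of_real r * a))"
        by (rule holomorphic_derivI[OF hol open_halfspace_Re_gt]) (use pos[OF that] in simp)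
      ultimately show ?thesis
        using field_vector_diff_chain_at by (fastforce simp: o_def)
    qed
    have "filterlim (\<lambda>r. 1 + of_real r * a) at_infinity at_top"
    proof (rule tendsto_add_filterlim_at_infinity[OF tendsto_const])
      have "filterlim (\<lambda>r. of_real r * a) at_infinity at_top"
        unfolding filterlim_at_infinity_conv_norm_at_top
        using a by (simp add: norm_mult filterlim_abs_real)
      then show "filterlim (\<lambda>r. of_real r * a) at_infinity at_top" .
    qed
    then have "filterlim (\<lambda>r. 1 + of_real r * a) half_plane_infinity at_top"
    proof (rule filterlim_half_plane_infinity)
      show "\<forall>\<^sub>F r in at_top. Re (1 + of_real r * a) > 0"
        using eventually_ge_at_top[of 0] by eventually_elim (rule pos)
    qed
    then show "((\<lambda>r. a * deriv G (1 + of_real r * a)) \<longlongrightarrow> a * \<beta>) at_top"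
      by (intro tendsto_intros filterlim_compose[OF lim])
  qed
  have nonneg: "Re (a * \<beta>) \<ge> 0" if a: "Re a \<ge> 0" "cmod a = 1" for a
  proof (rule tendsto_lowerbound)
    show "((\<lambda>r. Re (G (1 + of_real r * a) / of_real r)) \<longlongrightarrow> Re (a * \<beta>)) at_top"
      by (intro tendsto_intros ray a)
    show "\<forall>\<^sub>F r in at_top. 0 \<le> Re (G (1 + of_real r * a) / of_real r)"
      using eventually_gt_at_top[of 0]
    proof eventually_elim
      case (elim r)
      have "Re (1 + of_real r * a) > 0"
        using elim a(1) by (simp add: add_pos_nonneg)
      then show ?case using elim im by (simp add: less_imp_le)
    qed
  qed simp
  \<comment> \<open>The directions \<i> and -\<i> give both signs of Im \<beta>; the direction 1
    gives the sign of Re \<beta>.\<close>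
  show im0: "Im \<beta> = 0" and re0: "Re \<beta> \<ge> 0"
    using nonneg[of 1] nonneg[of \<i>] nonneg[of "- \<i>"] by auto
  show "Re \<beta> * Re w \<le> Re (G w)"
  proof (cases "Re \<beta> = 0")
    case True
    then show ?thesis using im[OF w] by simp
  next
    case False
    define x where "x r = (1 + of_real r :: complex)" for r :: real
    have G_lim: "((\<lambda>r. G (x r) / of_real r) \<longlongrightarrow> \<beta>) at_top"
      using ray[of 1] by (simp add: x_def)
    have x_lim: "((\<lambda>r. x r / of_real r) \<longlongrightarrow> 1) at_top"
    proof (rule vector_derivative_limit_imp_ratio_limit[where f' = "\<lambda>_. 1"])
      show "(x has_vector_derivative 1) (at t)" for t
        unfolding x_def[abs_def]
        by (auto intro!: derivative_eq_intros simp: has_vector_derivative_def scaleR_conv_of_real)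
    qed simp
    have inv: "((\<lambda>r::real. 1 / of_real r :: complex) \<longlongrightarrow> 0) at_top"
      using tendsto_of_real[OF tendsto_inverse_0_at_top[OF filterlim_ident], where 'a = complex]
      by (simp add: divide_inverse)
    \<comment> \<open>The inequality \<open>Schwarz_Pick_half_plane_Re\<close> at \<open>w\<close>
      and \<open>x r\<close>, divided by r^3, in the limit. As \<beta> is real and nonzero here, one
      factor Re \<beta> cancels afterwards.\<close>
    have "Re w * 1 * (cmod (0 + cnj \<beta>))\<^sup>2 \<le> Re (G w) * Re \<beta> * (cmod (0 + cnj 1))\<^sup>2"
    proof (rule tendsto_le)
      show "((\<lambda>r. Re w * Re (x r / of_real r) * (cmod (G w * (1 / of_real r) + cnj (G (x r) / of_real r)))\<^sup>2)
          \<longlongrightarrow> Re w * 1 * (cmod (0 + cnj \<beta>))\<^sup>2) at_top"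
        using tendsto_Re[OF x_lim]
        by (intro tendsto_intros G_lim tendsto_mult_right_zero inv) simp
      show "((\<lambda>r. Re (G w) * Re (G (x r) / of_real r) * (cmod (w * (1 / of_real r) + cnj (x r / of_real r)))\<^sup>2)
          \<longlongrightarrow> Re (G w) * Re \<beta> * (cmod (0 + cnj 1))\<^sup>2) at_top"
        by (intro tendsto_intros G_lim tendsto_mult_right_zero inv x_lim)
      show "\<forall>\<^sub>F r in at_top.
          Re w * Re (x r / of_real r) * (cmod (G w * (1 / of_real r) + cnj (G (x r) / of_real r)))\<^sup>2
          \<le> Re (G w) * Re (G (x r) / of_real r) * (cmod (w * (1 / of_real r) + cnj (x r / of_real r)))\<^sup>2"
        using eventually_gt_at_top[of 0]
      proof eventually_elim
        case (elim r)
        have "Re (x r) > 0" using elim by (simp add: x_def)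
        have scale: "(cmod (a * (1 / of_real r) + cnj (b / of_real r)))\<^sup>2 = (cmod (a + cnj b))\<^sup>2 / r\<^sup>2" for a b
        proof -
          have "a * (1 / of_real r) + cnj (b / of_real r) = (a + cnj b) / of_real r"
            by (simp add: add_divide_distrib)
          then show ?thesis
            by (simp only: norm_divide power_divide) simp
        qed
        show ?case
          unfolding scale
          using Schwarz_Pick_half_plane_Re[OF hol im w \<open>Re (x r) > 0\<close>] elim
          by (simp add: field_simps)
      qed
    qed simp
    moreover have "(cmod (0 + cnj \<beta>))\<^sup>2 = Re \<beta> * Re \<beta>"
      unfolding cmod_power2 using im0 by (simp add: power2_eq_square)
    ultimately have "Re \<beta> * (Re \<beta> * Re w) \<le> Re \<beta> * Re (G w)"
      by (simp add: mult_ac)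
    then show ?thesis using False re0 by simp
  qed
qed

subsection \<open>Flows conjugate to a translation\<close>

text \<open>The class \<open>Sigma1\<close> seen from the half-plane: \<open>g\<close> conjugates
  the flow to translation, and convergence to the boundary point 1 becomes escape to
  infinity.\<close>

locale half_plane_shift =
  fixes g :: "complex \<Rightarrow> complex"
  assumes hol: "g holomorphic_on right_half_plane"
    and inj: "inj_on g right_half_plane"
    and shift: "Re w > 0 \<Longrightarrow> t \<ge> 0 \<Longrightarrow> g w + of_real t \<in> g ` right_half_plane"
    and escape: "Re w > 0 \<Longrightarrow>
      filterlim (\<lambda>t. inv_into right_half_plane g (g w + of_real t)) at_infinity at_top"
begin

definition flow :: "real \<Rightarrow> complex \<Rightarrow> complex" where
  "flow t w = inv_into right_half_plane g (g w + of_real t)"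

lemma flow_pos: "Re w > 0 \<Longrightarrow> t \<ge> 0 \<Longrightarrow> Re (flow t w) > 0"
  using inv_into_into[OF shift] by (simp add: flow_def)

lemma g_flow: "Re w > 0 \<Longrightarrow> t \<ge> 0 \<Longrightarrow> g (flow t w) = g w + of_real t"
  using f_inv_into_f[OF shift] by (simp add: flow_def)

lemma flow_eqI: "Re v > 0 \<Longrightarrow> g v = g w + of_real t \<Longrightarrow> flow t w = v"
  using inv_into_f_f[OF inj, of v] by (simp add: flow_def)

lemma flow_0: "Re w > 0 \<Longrightarrow> flow 0 w = w"
  by (rule flow_eqI) auto

lemma flow_add:
  assumes "Re w > 0" "s \<ge> 0" "t \<ge> 0"
  shows "flow s (flow t w) = flow (s + t) w"
  using assms by (intro flow_eqI[symmetric]) (auto simp: g_flow flow_pos)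

lemma flow_at_infinity: "Re w > 0 \<Longrightarrow> filterlim (\<lambda>t. flow t w) at_infinity at_top"
  unfolding flow_def by (rule escape)

lemma flow_half_plane_infinity:
  assumes "Re w > 0"
  shows "filterlim (\<lambda>t. flow t w) half_plane_infinity at_top"
proof (rule filterlim_half_plane_infinity[OF flow_at_infinity[OF assms]])
  show "\<forall>\<^sub>F t in at_top. Re (flow t w) > 0"
    using eventually_ge_at_top[of 0] by eventually_elim (rule flow_pos[OF assms])
qed

lemma g_deriv: "Re w > 0 \<Longrightarrow> (g has_field_derivative deriv g w) (at w)"
  by (rule holomorphic_derivI[OF hol open_halfspace_Re_gt]) simp

lemma deriv_g_nonzero: "Re w > 0 \<Longrightarrow> deriv g w \<noteq> 0"
  by (rule holomorphic_injective_imp_regular[OF hol open_halfspace_Re_gt inj]) simp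

lemma inverse_deriv:
  assumes z: "Re z > 0"
  shows "(inv_into right_half_plane g has_field_derivative 1 / deriv g z) (at (g z))"
proof -
  obtain k where k: "k holomorphic_on (g ` right_half_plane)"
    "\<And>z. z \<in> right_half_plane \<Longrightarrow> deriv g z * deriv k (g z) = 1"
    "\<And>z. z \<in> right_half_plane \<Longrightarrow> k (g z) = z"
    using holomorphic_has_inverse[OF hol open_halfspace_Re_gt inj] by blast
  have op: "open (g ` right_half_plane)"
    by (rule open_mapping_thm3[OF hol open_halfspace_Re_gt inj])
  have "(k has_field_derivative deriv k (g z)) (at (g z))"
    by (rule holomorphic_derivI[OF k(1) op]) (use z in simp)
  moreover have "deriv k (g z) = 1 / deriv g z"
    using k(2)[of z] deriv_g_nonzero[OF z] z by (simp add: field_simps)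
  ultimately have "(k has_field_derivative 1 / deriv g z) (at (g z))" by simp
  \<comment> \<open>The inverse function \<open>k\<close> and \<open>inv_into\<close> are known to
    agree only on the image of \<open>g\<close>, which is open, so the derivative carries
    over.\<close>
  then show ?thesis
  proof (rule has_field_derivative_transform_within_open[OF _ op])
    show "k x = inv_into right_half_plane g x" if "x \<in> g ` right_half_plane" for x
      using that k(3) inv_into_f_f[OF inj] by auto
  qed (use z in auto)
qed

lemma flow_field_derivative:
  assumes "Re w > 0" "t \<ge> 0"
  shows "(flow t has_field_derivative deriv g w / deriv g (flow t w)) (at w)"
proof -
  have "((\<lambda>w. g w + of_real t) has_field_derivative deriv g w) (at w)"
    using g_deriv[OF assms(1)] by (auto intro!: derivative_eq_intros)
  moreover have "(inv_into right_half_plane g has_field_derivative 1 / deriv g (flow t w)) (at (g w + of_real t))"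
    using inverse_deriv[OF flow_pos[OF assms]] by (simp add: g_flow assms)
  ultimately show ?thesis
    unfolding flow_def[abs_def] using DERIV_chain2 by fastforce
qed

lemma flow_holomorphic: "t \<ge> 0 \<Longrightarrow> flow t holomorphic_on right_half_plane"
  using flow_field_derivative
  by (auto simp: holomorphic_on_open[OF open_halfspace_Re_gt])

lemma flow_vector_derivative:
  assumes "Re w > 0" "t \<ge> 0"
  shows "((\<lambda>t. flow t w) has_vector_derivative 1 / deriv g (flow t w)) (at t)"
proof -
  have "((\<lambda>t. g w + of_real t) has_vector_derivative 1) (at t)"
    by (auto intro!: derivative_eq_intros simp: has_vector_derivative_def scaleR_conv_of_real)
  moreover have "(inv_into right_half_plane g has_field_derivative 1 / deriv g (flow t w)) (at (g w + of_real t))"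
    using inverse_deriv[OF flow_pos[OF assms]] by (simp add: g_flow assms)
  ultimately have "((inv_into right_half_plane g \<circ> (\<lambda>t. g w + of_real t)) has_vector_derivative
      1 * (1 / deriv g (flow t w))) (at t)"
    by (rule field_vector_diff_chain_at)
  then show ?thesis by (simp add: o_def flow_def)
qed

text \<open>Julia's lemma for the self-map \<open>flow t\<close>: its iterates are
  \<open>flow (t * real n)\<close>, which escape to infinity when t > 0.\<close>

lemma Re_flow_ge:
  assumes w: "Re w > 0" and t: "t \<ge> 0"
  shows "Re w \<le> Re (flow t w)"
proof (cases "t = 0")
  case False
  have iter: "(flow t ^^ n) w = flow (t * real n) w" for n
    by (induction n) (use w t in \<open>auto simp: flow_0 flow_add algebra_simps\<close>)
  have "filterlim (\<lambda>n. t * real n) at_top sequentially"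
    using False t
    by (intro filterlim_tendsto_pos_mult_at_top[OF tendsto_const] filterlim_real_sequentially) auto
  then have "filterlim (\<lambda>n. flow (t * real n) w) at_infinity sequentially"
    by (rule filterlim_compose[OF flow_at_infinity[OF w]])
  then show ?thesis
    using t w by (intro Julia_half_plane[where v = w] flow_holomorphic) (auto simp: flow_pos iter)
qed (use w flow_0 in simp)

lemma Re_flow_mono:
  assumes w: "Re w > 0" and "0 \<le> s" "s \<le> t"
  shows "Re (flow s w) \<le> Re (flow t w)"
  using Re_flow_ge[OF flow_pos[OF w \<open>0 \<le> s\<close>], of "t - s"] assms by (simp add: flow_add)

text \<open>Since Re (flow t w) does not decrease, its derivative Re (1 / g' w) at time 0 cannot be
  negative, and inversion preserves the sign of the real part.\<close>

lemma Re_deriv_g_nonneg: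
  assumes w: "Re w > 0"
  shows "Re (deriv g w) \<ge> 0"
proof -
  have "((\<lambda>t. Re (flow t w)) has_real_derivative Re (1 / deriv g w)) (at 0)"
    using flow_vector_derivative[OF w order_refl] flow_0[OF w]
    by (simp add: has_vector_derivative_complex_iff)
  then have "\<not> Re (1 / deriv g w) < 0"
  proof (rule contrapos_pn)
    assume neg: "Re (1 / deriv g w) < 0"
    show "\<not> ((\<lambda>t. Re (flow t w)) has_real_derivative Re (1 / deriv g w)) (at 0)"
    proof
      assume "((\<lambda>t. Re (flow t w)) has_real_derivative Re (1 / deriv g w)) (at 0)"
      from DERIV_neg_dec_right[OF this neg] obtain d where
        "d > 0" "\<And>h. h > 0 \<Longrightarrow> h < d \<Longrightarrow> Re (flow 0 w) > Re (flow (0 + h) w)" by blast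
      then have "Re (flow 0 w) > Re (flow (d / 2) w)"
        by (metis add_0 field_sum_of_halves half_gt_zero less_add_same_cancel1)
      then show False using Re_flow_mono[OF w, of 0 "d / 2"] \<open>d > 0\<close> by simp
    qed
  qed
  moreover have "Re (1 / deriv g w) = Re (deriv g w) / (cmod (deriv g w))\<^sup>2"
    by (simp add: Re_divide cmod_power2)
  ultimately show ?thesis
    using deriv_g_nonzero[OF w] by (simp add: not_less zero_le_divide_iff)
qed

text \<open>Trajectories have velocity \<open>1 / g'\<close>, so this says that their hyperbolic speed does not
  increase.\<close>

lemma flow_speed_bound:
  assumes w: "Re w > 0" and t: "t \<ge> 0"
  shows "cmod (deriv g w) * Re w \<le> cmod (deriv g (flow t w)) * Re (flow t w)"
proof -
  have "cmod (deriv (flow t) w) * Re w \<le> Re (flow t w)"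
    using t w by (intro Schwarz_Pick_half_plane_deriv flow_holomorphic flow_pos)
  moreover have "deriv (flow t) w = deriv g w / deriv g (flow t w)"
    by (rule DERIV_imp_deriv[OF flow_field_derivative[OF w t]])
  ultimately show ?thesis
    using deriv_g_nonzero[OF flow_pos[OF w t]] by (simp add: norm_divide field_simps)
qed

lemma Re_flow_le_limit:
  assumes w: "Re w > 0" and L: "((\<lambda>t. Re (flow t w)) \<longlongrightarrow> L) at_top" and t: "t \<ge> 0"
  shows "Re (flow t w) \<le> L"
proof (rule tendsto_lowerbound[OF L])
  show "\<forall>\<^sub>F s in at_top. Re (flow t w) \<le> Re (flow s w)"
    using eventually_ge_at_top[of t] by eventually_elim (rule Re_flow_mono[OF w t])
qed simp

lemma bounded_Re_flow_converges:
  assumes w: "Re w > 0" and bound: "\<And>t. t \<ge> 0 \<Longrightarrow> Re (flow t w) \<le> M"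
  obtains L where "((\<lambda>t. Re (flow t w)) \<longlongrightarrow> L) at_top"
proof
  have bdd: "bdd_above ((\<lambda>t. Re (flow t w)) ` {0..})"
    using bound by (auto intro!: bdd_aboveI[of _ M])
  show "((\<lambda>t. Re (flow t w)) \<longlongrightarrow> (SUP t\<in>{0..}. Re (flow t w))) at_top"
  proof (rule increasing_tendsto)
    show "\<forall>\<^sub>F t in at_top. Re (flow t w) \<le> (SUP t\<in>{0..}. Re (flow t w))"
      using eventually_ge_at_top[of 0] by eventually_elim (rule cSUP_upper[OF _ bdd], simp)
    fix x assume "x < (SUP t\<in>{0..}. Re (flow t w))"
    then obtain s where s: "s \<ge> 0" "x < Re (flow s w)"
      using less_cSUP_iff[OF _ bdd] by auto
    show "\<forall>\<^sub>F t in at_top. x < Re (flow t w)"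
      using eventually_ge_at_top[of s]
      by eventually_elim (use s Re_flow_mono[OF w] in \<open>auto intro: less_le_trans\<close>)
  qed
qed

section \<open>Asymptotics of trajectories when the derivative of \<open>g\<close> converges\<close>

lemma flow_ratio_limit:
  assumes w: "Re w > 0" and c: "c \<noteq> 0" and lim: "(deriv g \<longlongrightarrow> c) half_plane_infinity"
  shows "((\<lambda>t. flow t w / of_real t) \<longlongrightarrow> 1 / c) at_top"
proof (rule vector_derivative_limit_imp_ratio_limit[OF flow_vector_derivative[OF w]])
  show "((\<lambda>t. 1 / deriv g (flow t w)) \<longlongrightarrow> 1 / c) at_top"
    by (intro tendsto_intros filterlim_compose[OF lim flow_half_plane_infinity[OF w]] c)
qed

text \<open>Two trajectories travel in the same direction, so the segment joining them escapes to
  infinity, where \<open>g\<close> is nearly affine with slope \<open>c\<close>, while the difference of the \<open>g\<close>-values is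
  constant in time.\<close>

lemma flow_difference_limit:
  assumes v: "Re v > 0" and w: "Re w > 0" and c: "c \<noteq> 0"
    and lim: "(deriv g \<longlongrightarrow> c) half_plane_infinity"
  shows "((\<lambda>t. flow t v - flow t w) \<longlongrightarrow> (g v - g w) / c) at_top"
proof (rule tendstoI)
  fix e :: real assume "e > 0"
  define D where "D = cmod (g v - g w)"
  \<comment> \<open>The first bound absorbs the error into |c| and yields |flow t v - flow t w| <= 2
    D / |c|; the second then makes the error smaller than |c| e. The summand 1 avoids a zero
    denominator when D = 0.\<close>
  define d where "d = min (cmod c / 2) (e * (cmod c)\<^sup>2 / (2 * D + 1) / 2)"
  have "D \<ge> 0" by (simp add: D_def)
  have d_le: "d \<le> cmod c / 2" "d \<le> e * (cmod c)\<^sup>2 / (2 * D + 1) / 2"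
    unfolding d_def by (rule min.cobounded1, rule min.cobounded2)
  have "d > 0" using \<open>D \<ge> 0\<close> \<open>e > 0\<close> c by (simp add: d_def)
  then obtain R where R: "\<And>z. cmod z \<ge> R \<Longrightarrow> Re z > 0 \<Longrightarrow> dist (deriv g z) c < d"
    using tendsto_half_plane_infinityD[OF lim] by blast
  have "cmod (1 / c) / 2 > 0" using c by simp
  then have near: "\<forall>\<^sub>F t in at_top. dist (flow t u / of_real t) (1 / c) < cmod (1 / c) / 2"
    if "Re u > 0" for u
    using tendstoD[OF flow_ratio_limit[OF that c lim]] by blast
  show "\<forall>\<^sub>F t in at_top. dist (flow t v - flow t w) ((g v - g w) / c) < e"
    using near[OF v] near[OF w] eventually_gt_at_top[of 0]
      eventually_ge_at_top[of "2 * cmod c * R"]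
  proof eventually_elim
    case (elim t)
    define S where "S = closed_segment (flow t v) (flow t w)"
    have S: "Re z > 0 \<and> cmod z \<ge> R" if z: "z \<in> S" for z
    proof
      have "S \<subseteq> right_half_plane"
        unfolding S_def using flow_pos v w elim(3)
        by (intro closed_segment_subset convex_halfspace_Re_gt) auto
      then show "Re z > 0" using z by auto
      obtain u where u: "0 \<le> u" "u \<le> 1" "z = (1 - u) *\<^sub>R flow t v + u *\<^sub>R flow t w"
        using z by (auto simp: S_def in_segment)
      have "z / of_real t = (1 - u) *\<^sub>R (flow t v / of_real t) + u *\<^sub>R (flow t w / of_real t)"
        unfolding u(3) by (simp add: add_divide_distrib scaleR_conv_of_real)
      \<comment> \<open>Both endpoints, divided by t, lie in this ball, hence so does the whole
        segment. Its points therefore have modulus above t / (2 |c|).\<close>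
      also have "\<dots> \<in> ball (1 / c) (cmod (1 / c) / 2)"
        using elim u by (intro convexD[OF convex_ball]) (auto simp: dist_commute)
      finally have "cmod (z / of_real t) > cmod (1 / c) / 2"
        using norm_triangle_ineq2[of "1 / c" "z / of_real t"] by (simp add: dist_norm)
      then have "t < 2 * cmod c * cmod z"
        using elim c by (simp add: norm_divide field_simps)
      with elim have "2 * cmod c * R < 2 * cmod c * cmod z" by linarith
      then show "cmod z \<ge> R"
        using c by simp
    qed
    \<comment> \<open>Mean value inequality for z -> g z - c z, whose derivative is at most d in
      modulus on the segment.\<close>
    have "cmod ((g (flow t v) - c * flow t v) - (g (flow t w) - c * flow t w))
        \<le> d * cmod (flow t v - flow t w)"
    proof (rule field_differentiable_bound)
      show "convex S" by (simp add: S_def)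
      show "((\<lambda>z. g z - c * z) has_field_derivative deriv g z - c) (at z within S)" if "z \<in> S" for z
        using S[OF that] by (auto intro!: derivative_eq_intros has_field_derivative_at_within[OF g_deriv])
      show "cmod (deriv g z - c) \<le> d" if "z \<in> S" for z
        using R S[OF that] by (auto simp: dist_norm intro: less_imp_le)
    qed (auto simp: S_def)
    moreover have "(g (flow t v) - c * flow t v) - (g (flow t w) - c * flow t w)
        = (g v - g w) - c * (flow t v - flow t w)"
      using v w elim by (simp add: g_flow algebra_simps)
    ultimately have *: "cmod ((g v - g w) - c * (flow t v - flow t w)) \<le> d * cmod (flow t v - flow t w)"
      by simp
    have "cmod c * cmod (flow t v - flow t w) - D \<le> d * cmod (flow t v - flow t w)"
      using * norm_triangle_ineq2[of "c * (flow t v - flow t w)" "g v - g w"]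
      by (simp add: D_def norm_mult norm_minus_commute)
    also have "\<dots> \<le> cmod c / 2 * cmod (flow t v - flow t w)"
      by (intro mult_right_mono d_le) auto
    finally have "cmod (flow t v - flow t w) \<le> 2 * D / cmod c"
      using c by (simp add: field_simps)
    then have "d * cmod (flow t v - flow t w) \<le> d * (2 * D / cmod c)"
      using \<open>d > 0\<close> by (intro mult_left_mono) auto
    also have "\<dots> \<le> e * (cmod c)\<^sup>2 / (2 * D + 1) / 2 * (2 * D / cmod c)"
      using \<open>D \<ge> 0\<close> by (intro mult_right_mono d_le) auto
    also have "\<dots> = cmod c * (e / 2 * (2 * D / (2 * D + 1)))"
      using c \<open>D \<ge> 0\<close> by (simp add: field_simps power2_eq_square)
    also have "\<dots> < cmod c * e"
    proof -
      have "2 * D / (2 * D + 1) \<le> 1" using \<open>D \<ge> 0\<close> by simp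
      then have "e / 2 * (2 * D / (2 * D + 1)) \<le> e / 2 * 1"
        using \<open>e > 0\<close> by (intro mult_left_mono) auto
      also have "\<dots> < e" using \<open>e > 0\<close> by simp
      finally show ?thesis using c by (intro mult_strict_left_mono) auto
    qed
    finally have "cmod ((g v - g w) - c * (flow t v - flow t w)) < cmod c * e"
      using * by linarith
    moreover have "(g v - g w) - c * (flow t v - flow t w)
        = - c * ((flow t v - flow t w) - (g v - g w) / c)"
      using c by (simp add: field_simps)
    ultimately show ?case
      using c by (simp add: dist_norm norm_mult del: mult_minus_left)
  qed
qed

text \<open>The rescaled trajectory tends to 1 / c, while a bounded real part divided by t tends to
  0.\<close>

lemma Re_slope_eq_0:
  assumes w: "Re w > 0" and c: "c \<noteq> 0" and lim: "(deriv g \<longlongrightarrow> c) half_plane_infinity"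
    and bound: "\<And>t. t \<ge> 0 \<Longrightarrow> Re (flow t w) \<le> M"
  shows "Re c = 0"
proof -
  have "((\<lambda>t. Re (flow t w / of_real t)) \<longlongrightarrow> 0) at_top"
  proof (rule Lim_null_comparison)
    show "\<forall>\<^sub>F t in at_top. norm (Re (flow t w / of_real t)) \<le> M * inverse t"
      using eventually_gt_at_top[of 0]
    proof eventually_elim
      case (elim t)
      then show ?case
        using bound[of t] flow_pos[OF w, of t] by (simp add: field_simps)
    qed
    show "((\<lambda>t. M * inverse t) \<longlongrightarrow> 0) at_top"
      using tendsto_mult[OF tendsto_const tendsto_inverse_0_at_top[OF filterlim_ident]] by fastforce
  qed
  then have "Re (1 / c) = 0"
    using tendsto_unique[OF _ tendsto_Re[OF flow_ratio_limit[OF w c lim]]] by simp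
  then show ?thesis using c by (auto simp: Re_divide complex_eq_iff)
qed

text \<open>For imaginary \<open>c\<close> the real part of (g v - g w) / c involves only imaginary
  parts of \<open>g\<close>. The new limit is positive because real parts increase from Re v > 0;
  this positivity is the source of the half-plane containing the image.\<close>

lemma Re_flow_limit_transfer:
  assumes v: "Re v > 0" and w: "Re w > 0" and c: "c \<noteq> 0" "Re c = 0"
    and lim: "(deriv g \<longlongrightarrow> c) half_plane_infinity"
    and L: "((\<lambda>t. Re (flow t w)) \<longlongrightarrow> L) at_top"
  shows "((\<lambda>t. Re (flow t v)) \<longlongrightarrow> L + (Im (g v) - Im (g w)) / Im c) at_top"
    and "L + (Im (g v) - Im (g w)) / Im c > 0"
proof -
  have "Re ((g v - g w) / c) = (Im (g v) - Im (g w)) / Im c"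
    using c by (simp add: Re_divide power2_eq_square)
  then have "((\<lambda>t. Re (flow t w) + Re (flow t v - flow t w)) \<longlongrightarrow> L + (Im (g v) - Im (g w)) / Im c) at_top"
    using tendsto_add[OF L tendsto_Re[OF flow_difference_limit[OF v w c(1) lim]]] by simp
  then show lim_v: "((\<lambda>t. Re (flow t v)) \<longlongrightarrow> L + (Im (g v) - Im (g w)) / Im c) at_top"
    by simp
  show "L + (Im (g v) - Im (g w)) / Im c > 0"
    using Re_flow_le_limit[OF v lim_v, of 0] v by (simp add: flow_0)
qed

text \<open>Rotating \<open>g\<close> by a right angle turns the one-sided bound into a self-map
  \<open>G\<close> of the half-plane. Translation by real t leaves Re G unchanged, so the positive
  slope of \<open>G\<close> at infinity bounds Re (flow t w).\<close>

lemma Im_bound_imp_bounded_Re: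
  assumes c: "c \<noteq> 0" and lim: "(deriv g \<longlongrightarrow> c) half_plane_infinity"
    and \<sigma>: "\<sigma> = 1 \<or> \<sigma> = (-1 :: real)"
    and bound: "\<And>w. Re w > 0 \<Longrightarrow> \<sigma> * Im (g w) \<ge> C"
    and w: "Re w > 0"
  obtains M where "\<And>t. t \<ge> 0 \<Longrightarrow> Re (flow t w) \<le> M"
proof
  \<comment> \<open>The constant 1 - C gives Re (G w) >= 1, hence strict positivity.\<close>
  define G where "G w = - \<i> * of_real \<sigma> * g w + of_real (1 - C)" for w
  define \<beta> where "\<beta> = - \<i> * of_real \<sigma> * c"
  have G_deriv: "(G has_field_derivative - \<i> * of_real \<sigma> * deriv g u) (at u)" if "Re u > 0" for u
    unfolding G_def[abs_def] using g_deriv[OF that] by (auto intro!: derivative_eq_intros)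
  have G_hol: "G holomorphic_on right_half_plane"
    unfolding G_def[abs_def] by (intro holomorphic_intros hol)
  have Re_G: "Re (G u) = \<sigma> * Im (g u) + 1 - C" for u by (simp add: G_def)
  have G_pos: "Re (G u) > 0" if "Re u > 0" for u
    using bound[OF that] by (simp add: Re_G)
  have "\<forall>\<^sub>F u in half_plane_infinity. - \<i> * of_real \<sigma> * deriv g u = deriv G u"
    unfolding half_plane_infinity_def eventually_inf_principal
    by (intro always_eventually) (auto simp: DERIV_imp_deriv[OF G_deriv])
  moreover have "((\<lambda>u. - \<i> * of_real \<sigma> * deriv g u) \<longlongrightarrow> \<beta>) half_plane_infinity"
    unfolding \<beta>_def by (intro tendsto_intros lim)
  ultimately have G_lim: "(deriv G \<longlongrightarrow> \<beta>) half_plane_infinity"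
    by (simp add: tendsto_cong)
  have \<beta>: "Im \<beta> = 0 \<and> Re \<beta> \<ge> 0 \<and> Re \<beta> * Re u \<le> Re (G u)" if "Re u > 0" for u
    by (intro conjI; rule derivative_at_infinity_pos[OF G_hol _ G_lim that]; rule G_pos)
  have "\<beta> \<noteq> 0" using c \<sigma> by (auto simp: \<beta>_def)
  then have "Re \<beta> > 0" using \<beta>[OF w] by (auto simp: complex_eq_iff)
  show "Re (flow t w) \<le> Re (G w) / Re \<beta>" if t: "t \<ge> 0" for t
  proof -
    have "Re \<beta> * Re (flow t w) \<le> Re (G (flow t w))"
      using \<beta>[OF flow_pos[OF w t]] by simp
    also have "\<dots> = Re (G w)" by (simp add: Re_G g_flow[OF w t])
    finally show ?thesis using \<open>Re \<beta> > 0\<close> by (simp add: field_simps)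
  qed
qed

end

section \<open>The growth exponent of a flow with bounded real part\<close>

lemma abs_Im_Ln_eq_arccos:
  assumes "Re z > 0"
  shows "\<bar>Im (Ln z)\<bar> = arccos (Re z / cmod z)"
proof -
  have nz: "z \<noteq> 0" using assms by auto
  have "Re z = Re (exp (Ln z))" using nz by simp
  also have "\<dots> = cmod z * cos \<bar>Im (Ln z)\<bar>"
    using nz by (simp add: Re_exp del: exp_Ln)
  finally have "Re z / cmod z = cos \<bar>Im (Ln z)\<bar>"
    using nz by (simp add: field_simps)
  moreover have "\<bar>Im (Ln z)\<bar> \<le> pi"
    using mpi_less_Im_Ln[OF nz] Im_Ln_le_pi[OF nz] by linarith
  ultimately show ?thesis using arccos_cos[of "\<bar>Im (Ln z)\<bar>"] by simp
qed

lemma Re_powr_of_real: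
  assumes "z \<noteq> 0"
  shows "Re (z powr of_real a) = cmod (z powr of_real a) * cos (a * \<bar>Im (Ln z)\<bar>)"
  using assms by (simp add: powr_def Re_exp abs_if)

text \<open>For w = (1 + z) / (1 - z) one has (w + 1) / 2 = 1 / (1 - z). The exponent 1 - \<alpha>
  combines -(1 + \<alpha>) with the two powers contributed by the derivative of the inverse Cayley
  transform.\<close>

locale half_plane_shift_power = half_plane_shift +
  fixes \<alpha> :: real and c :: complex
  assumes c: "c \<noteq> 0"
    and growth: "((\<lambda>w. deriv g w * ((w + 1) / 2) powr of_real (1 - \<alpha>)) \<longlongrightarrow> c) half_plane_infinity"
begin

text \<open>By \<open>flow_speed_bound\<close> and Re (flow t w) <= M, the derivative of
  \<open>g\<close> stays above a positive constant in modulus along the trajectory. For \<alpha> < 1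
  the growth condition would force it to 0.\<close>

lemma bounded_Re_imp_order_ge_1:
  assumes w: "Re w > 0" and bound: "\<And>t. t \<ge> 0 \<Longrightarrow> Re (flow t w) \<le> M"
  shows "\<alpha> \<ge> 1"
proof (rule ccontr)
  assume "\<not> \<alpha> \<ge> 1"
  define K where "K = cmod (deriv g w) * Re w / M"
  have "M > 0" using bound[of 0] w by (simp add: flow_0)
  then have "K > 0" using w deriv_g_nonzero[OF w] by (simp add: K_def)
  have K: "K \<le> cmod (deriv g (flow t w))" if "t \<ge> 0" for t
  proof -
    have "cmod (deriv g w) * Re w \<le> cmod (deriv g (flow t w)) * Re (flow t w)"
      by (rule flow_speed_bound[OF w that])
    also have "\<dots> \<le> cmod (deriv g (flow t w)) * M"
      by (intro mult_left_mono bound that) auto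
    finally show ?thesis using \<open>M > 0\<close> by (simp add: K_def field_simps)
  qed
  have "filterlim (\<lambda>t. flow t w + 1) at_infinity at_top"
    by (rule tendsto_add_filterlim_at_infinity'[OF flow_at_infinity[OF w] tendsto_const])
  then have "filterlim (\<lambda>t. cmod (flow t w + 1)) at_top at_top"
    by (simp add: filterlim_at_infinity_conv_norm_at_top)
  then have "filterlim (\<lambda>t. (1/2) * cmod (flow t w + 1)) at_top at_top"
    by (intro filterlim_tendsto_pos_mult_at_top[OF tendsto_const]) auto
  then have "filterlim (\<lambda>t. cmod ((flow t w + 1) / 2)) at_top at_top"
    by (simp add: norm_divide)
  then have "((\<lambda>t. cmod ((flow t w + 1) / 2) powr (\<alpha> - 1)) \<longlongrightarrow> 0) at_top"
    by (intro tendsto_neg_powr) (use \<open>\<not> \<alpha> \<ge> 1\<close> in simp)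
  moreover have "((\<lambda>t. cmod (deriv g (flow t w) * ((flow t w + 1) / 2) powr of_real (1 - \<alpha>))) \<longlongrightarrow> cmod c) at_top"
    by (intro tendsto_norm filterlim_compose[OF growth flow_half_plane_infinity[OF w]])
  ultimately have "((\<lambda>t. cmod (deriv g (flow t w) * ((flow t w + 1) / 2) powr of_real (1 - \<alpha>))
      * cmod ((flow t w + 1) / 2) powr (\<alpha> - 1)) \<longlongrightarrow> cmod c * 0) at_top"
    by (intro tendsto_mult)
  moreover have "\<forall>\<^sub>F t in at_top. K \<le> cmod (deriv g (flow t w) * ((flow t w + 1) / 2) powr of_real (1 - \<alpha>))
      * cmod ((flow t w + 1) / 2) powr (\<alpha> - 1)"
    using eventually_ge_at_top[of 0]
  proof eventually_elim
    case (elim t)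
    have "flow t w + 1 \<noteq> 0" using flow_pos[OF w elim] by (auto simp: complex_eq_iff)
    then have "cmod ((flow t w + 1) / 2) powr (1 - \<alpha>) * cmod ((flow t w + 1) / 2) powr (\<alpha> - 1) = 1"
      by (subst powr_add[symmetric]) simp
    moreover have "cmod (((flow t w + 1) / 2) powr of_real (1 - \<alpha>)) = cmod ((flow t w + 1) / 2) powr (1 - \<alpha>)"
      by (subst norm_powr_real_powr') auto
    ultimately show ?case
      using K[OF elim] by (simp only: norm_mult mult.assoc mult_1_right)
  qed
  ultimately have "K \<le> cmod c * 0"
    by (intro tendsto_lowerbound) auto
  then show False using \<open>K > 0\<close> by simp
qed

text \<open>On the positive real axis the power is positive, so the sign of Re g' passes to the
  limit.\<close>

lemma Re_leading_coefficient_nonneg: "Re c \<ge> 0"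
proof (rule tendsto_lowerbound)
  have "filterlim (\<lambda>x. complex_of_real x) half_plane_infinity at_top"
    by (intro filterlim_half_plane_infinity filterlim_of_real_at_infinity) auto
  then show "((\<lambda>x. Re (deriv g (of_real x) * ((of_real x + 1) / 2) powr of_real (1 - \<alpha>))) \<longlongrightarrow> Re c) at_top"
    by (intro tendsto_Re filterlim_compose[OF growth])
  show "\<forall>\<^sub>F x in at_top. 0 \<le> Re (deriv g (of_real x) * ((of_real x + 1) / 2) powr of_real (1 - \<alpha>))"
    using eventually_gt_at_top[of 0]
  proof eventually_elim
    case (elim x)
    have "((of_real x + 1) / 2 :: complex) powr of_real (1 - \<alpha>) = of_real (((x + 1) / 2) powr (1 - \<alpha>))"
      using elim powr_of_real[of "(x + 1) / 2" "1 - \<alpha>"] by simp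
    then show ?case
      using Re_deriv_g_nonneg[of "of_real x"] elim by simp
  qed
qed simp

text \<open>A trajectory with bounded real part escapes vertically, so raising it to a power
  \<alpha> in (1, 2] turns its direction into the left half-plane. The asymptotic direction is also
  that of 1 / c, which has nonnegative real part.\<close>

lemma bounded_Re_imp_order_le_1:
  assumes w: "Re w > 0" and bound: "\<And>t. t \<ge> 0 \<Longrightarrow> Re (flow t w) \<le> M" and "\<alpha> \<le> 2"
  shows "\<alpha> \<le> 1"
proof (rule ccontr)
  assume "\<not> \<alpha> \<le> 1"
  define p where "p t = (flow t w + 1) / 2" for t
  \<comment> \<open>The derivative of \<open>p t powr \<alpha>\<close> is \<alpha> / 2 divided by
    the expression in \<open>growth\<close> at \<open>flow t w\<close>, which tends to
    \<open>c\<close>.\<close>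
  define L where "L = of_real \<alpha> * (inverse c / 2)"
  have p_pos: "Re (p t) > 0" if "t \<ge> 0" for t
    using flow_pos[OF w that] by (simp add: p_def)
  have p_ratio: "((\<lambda>t. p t powr of_real \<alpha> / of_real t) \<longlongrightarrow> L) at_top"
  proof (rule vector_derivative_limit_imp_ratio_limit)
    show "((\<lambda>t. p t powr of_real \<alpha>) has_vector_derivative
        of_real \<alpha> * (inverse (deriv g (flow t w) * p t powr of_real (1 - \<alpha>)) / 2)) (at t)"
      if t: "t \<ge> 0" for t
    proof -
      have "(p has_vector_derivative 1 / deriv g (flow t w) / 2) (at t)"
        unfolding p_def[abs_def]
        using flow_vector_derivative[OF w t] by (auto intro!: derivative_eq_intros)
      moreover have "p t \<notin> \<real>\<^sub>\<le>\<^sub>0"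
        using p_pos[OF t] by (auto simp: complex_nonpos_Reals_iff)
      then have "((\<lambda>z. z powr of_real \<alpha>) has_field_derivative
          of_real \<alpha> * p t powr (of_real \<alpha> - 1)) (at (p t))"
        by (rule has_field_derivative_powr)
      moreover have "p t powr (of_real \<alpha> - 1) = inverse (p t powr of_real (1 - \<alpha>))"
        by (simp flip: powr_minus)
      ultimately show ?thesis
        using field_vector_diff_chain_at by (fastforce simp: o_def field_simps)
    qed
    show "((\<lambda>t. of_real \<alpha> * (inverse (deriv g (flow t w) * p t powr of_real (1 - \<alpha>)) / 2)) \<longlongrightarrow> L) at_top"
      unfolding L_def p_def
      by (intro tendsto_intros filterlim_compose[OF growth flow_half_plane_infinity[OF w]] c) simp
  qed
  \<comment> \<open>The absolute value of the argument tends to pi / 2 whether the trajectory goes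
    up or down; cosine is even, so the sign does not matter below.\<close>
  have "((\<lambda>t. \<bar>Im (Ln (p t))\<bar>) \<longlongrightarrow> arccos 0) at_top"
  proof -
    have "((\<lambda>t. Re (p t) / cmod (p t)) \<longlongrightarrow> 0) at_top"
    proof (rule Lim_null_comparison)
      show "\<forall>\<^sub>F t in at_top. norm (Re (p t) / cmod (p t)) \<le> (M + 1) * inverse (cmod (flow t w + 1))"
        using eventually_ge_at_top[of 0]
      proof eventually_elim
        case (elim t)
        then have "Re (p t) * 2 \<le> M + 1" using bound[OF elim] by (simp add: p_def)
        then show ?case
          using p_pos[OF elim] by (simp add: p_def norm_divide divide_simps)
      qed
      have "filterlim (\<lambda>t. flow t w + 1) at_infinity at_top"
        by (rule tendsto_add_filterlim_at_infinity'[OF flow_at_infinity[OF w] tendsto_const])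
      then have "((\<lambda>t. inverse (flow t w + 1)) \<longlongrightarrow> 0) at_top"
        by (rule filterlim_compose[OF tendsto_inverse_0])
      then have "((\<lambda>t. (M + 1) * cmod (inverse (flow t w + 1))) \<longlongrightarrow> (M + 1) * 0) at_top"
        by (intro tendsto_intros tendsto_norm_zero)
      then show "((\<lambda>t. (M + 1) * inverse (cmod (flow t w + 1))) \<longlongrightarrow> 0) at_top"
        by (simp add: norm_inverse)
    qed
    then have "((\<lambda>t. arccos (Re (p t) / cmod (p t))) \<longlongrightarrow> arccos 0) at_top"
      by (rule isCont_tendsto_compose[OF isCont_arccos, rotated 2]) auto
    moreover have "\<forall>\<^sub>F t in at_top. arccos (Re (p t) / cmod (p t)) = \<bar>Im (Ln (p t))\<bar>"
      using eventually_ge_at_top[of 0]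
      by eventually_elim (simp add: abs_Im_Ln_eq_arccos p_pos)
    ultimately show ?thesis by (simp add: tendsto_cong)
  qed
  then have "((\<lambda>t. cmod (p t powr of_real \<alpha> / of_real t) * cos (\<alpha> * \<bar>Im (Ln (p t))\<bar>))
      \<longlongrightarrow> cmod L * cos (\<alpha> * arccos 0)) at_top"
    by (intro tendsto_intros p_ratio)
  moreover have "\<forall>\<^sub>F t in at_top. cmod (p t powr of_real \<alpha> / of_real t) * cos (\<alpha> * \<bar>Im (Ln (p t))\<bar>)
      = Re (p t powr of_real \<alpha> / of_real t)"
    using eventually_gt_at_top[of 0]
  proof eventually_elim
    case (elim t)
    then have "p t \<noteq> 0" using p_pos[of t] by auto
    then show ?case
      using Re_powr_of_real[of "p t" \<alpha>] elim by (simp add: norm_divide)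
  qed
  ultimately have "((\<lambda>t. Re (p t powr of_real \<alpha> / of_real t)) \<longlongrightarrow> cmod L * cos (\<alpha> * arccos 0)) at_top"
    by (simp add: tendsto_cong)
  then have "Re L = cmod L * cos (\<alpha> * (pi / 2))"
    using tendsto_unique[OF _ tendsto_Re[OF p_ratio]] by (simp add: arccos_0)
  moreover have "cmod L > 0" using c \<open>\<not> \<alpha> \<le> 1\<close> by (simp add: L_def)
  \<comment> \<open>Here 1 < \<alpha> <= 2 places the angle in (pi / 2, pi], where cosine is
    negative.\<close>
  moreover have "cos (\<alpha> * (pi / 2)) < 0"
  proof -
    have "cos (\<alpha> * (pi / 2)) < cos (pi / 2)"
      using \<open>\<not> \<alpha> \<le> 1\<close> \<open>\<alpha> \<le> 2\<close> by (intro cos_monotone_0_pi) auto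
    then show ?thesis by simp
  qed
  ultimately have "Re L < 0" by (simp add: mult_pos_neg)
  moreover have "Re L \<ge> 0"
    using Re_leading_coefficient_nonneg \<open>\<not> \<alpha> \<le> 1\<close> by (simp add: L_def)
  ultimately show False by simp
qed

end

subsection \<open>Transfer to the disk\<close>

definition cayley :: "complex \<Rightarrow> complex" where
  "cayley z = (1 + z) / (1 - z)"

definition inv_cayley :: "complex \<Rightarrow> complex" where
  "inv_cayley w = (w - 1) / (w + 1)"

lemma inv_cayley_cayley: "z \<noteq> 1 \<Longrightarrow> inv_cayley (cayley z) = z"
  by (simp add: cayley_def inv_cayley_def divide_simps)

lemma cayley_inv_cayley: "w + 1 \<noteq> 0 \<Longrightarrow> cayley (inv_cayley w) = w"
  by (simp add: cayley_def inv_cayley_def divide_simps)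

text \<open>Horodisks at 1 become half-planes with vertical boundary. On the unit circle, including
  z = 1, both sides are 0 because division by 0 gives 0.\<close>

lemma Re_cayley: "Re (cayley z) = 1 / horo_dist z"
  unfolding cayley_def horo_dist_def Re_divide cmod_power2
  by (simp add: power2_eq_square algebra_simps)

lemma Re_cayley_pos: "cmod z < 1 \<Longrightarrow> Re (cayley z) > 0"
  unfolding Re_cayley horo_dist_def
  by (auto intro!: divide_pos_pos simp: abs_square_less_1)

lemma cmod_inv_cayley:
  assumes "Re w > 0"
  shows "cmod (inv_cayley w) < 1"
proof -
  have "(cmod (w - 1))\<^sup>2 < (cmod (w + 1))\<^sup>2"
    unfolding cmod_power2 using assms by (simp add: power2_eq_square algebra_simps)
  then have "cmod (w - 1) < cmod (w + 1)"
    by (rule power_less_imp_less_base) auto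
  then show ?thesis
    unfolding inv_cayley_def norm_divide by (subst divide_less_eq_1) auto
qed

lemma one_minus_inv_cayley: "w + 1 \<noteq> 0 \<Longrightarrow> 1 - inv_cayley w = inverse ((w + 1) / 2)"
  by (simp add: inv_cayley_def divide_simps)

lemma inv_cayley_deriv:
  assumes "w + 1 \<noteq> 0"
  shows "(inv_cayley has_field_derivative 2 / (w + 1)\<^sup>2) (at w)"
  unfolding inv_cayley_def[abs_def] using assms
  by (auto intro!: derivative_eq_intros simp: power2_eq_square divide_simps)

text \<open>Transports unrestricted limits at 1 to infinity, using inv_cayley w = 1 - 2 / (w +
  1).\<close>

lemma filterlim_inv_cayley: "filterlim inv_cayley (at 1 within unit_disk) half_plane_infinity"
proof -
  have pos: "\<forall>\<^sub>F w in half_plane_infinity. Re w > 0"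
    by (simp add: half_plane_infinity_def eventually_inf_principal)
  have "filterlim (\<lambda>w::complex. w) at_infinity half_plane_infinity"
    by (simp add: half_plane_infinity_def filterlim_def)
  then have "filterlim (\<lambda>w::complex. w + 1) at_infinity half_plane_infinity"
    by (rule tendsto_add_filterlim_at_infinity'[OF _ tendsto_const])
  then have "((\<lambda>w::complex. inverse (w + 1)) \<longlongrightarrow> 0) half_plane_infinity"
    by (rule filterlim_compose[OF tendsto_inverse_0])
  then have "((\<lambda>w::complex. 1 - 2 * inverse (w + 1)) \<longlongrightarrow> 1 - 2 * 0) half_plane_infinity"
    by (intro tendsto_intros)
  moreover have "\<forall>\<^sub>F w in half_plane_infinity. 1 - 2 * inverse (w + 1) = inv_cayley w"
    using pos
  proof eventually_elim
    case (elim w)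
    then have "w + 1 \<noteq> 0" by (auto simp: complex_eq_iff)
    then show ?case by (simp add: inv_cayley_def field_simps)
  qed
  ultimately have "(inv_cayley \<longlongrightarrow> 1) half_plane_infinity"
    by (simp add: tendsto_cong)
  moreover have "\<forall>\<^sub>F w in half_plane_infinity. inv_cayley w \<in> unit_disk \<and> inv_cayley w \<noteq> 1"
      using pos
  proof eventually_elim
    case (elim w)
    then show ?case using cmod_inv_cayley[OF elim] by auto
  qed
  ultimately show ?thesis by (simp add: filterlim_at)
qed

lemma filterlim_cayley: "filterlim cayley at_infinity (at 1)"
  unfolding cayley_def
proof (rule filterlim_divide_at_infinity)
  show "((\<lambda>z. 1 + z) \<longlongrightarrow> 1 + 1) (at (1 :: complex))"
    by (intro tendsto_intros)
  have "((\<lambda>z. 1 - z) \<longlongrightarrow> 1 - 1) (at (1 :: complex))"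
    by (intro tendsto_intros)
  then show "filterlim (\<lambda>z. 1 - z) (at 0) (at (1 :: complex))"
    by (auto simp: filterlim_at eventually_at_filter)
qed simp

definition to_half_plane :: "(complex \<Rightarrow> complex) \<Rightarrow> complex \<Rightarrow> complex" where
  "to_half_plane h w = h (inv_cayley w)"

lemma to_half_plane_cayley: "cmod z < 1 \<Longrightarrow> to_half_plane h (cayley z) = h z"
  by (subst to_half_plane_def, subst inv_cayley_cayley) auto

section \<open>The semiflow in the disk as a flow in the half-plane\<close>

context
  fixes h :: "complex \<Rightarrow> complex"
  assumes h: "h \<in> Sigma1"
begin

lemma semiflow_in_disk: "cmod z < 1 \<Longrightarrow> t \<ge> 0 \<Longrightarrow> cmod (semiflow h t z) < 1"
  using h inv_into_into[of "h z + of_real t" h unit_disk]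
  by (auto simp: Sigma1_def semiflow_def)

lemma h_semiflow: "cmod z < 1 \<Longrightarrow> t \<ge> 0 \<Longrightarrow> h (semiflow h t z) = h z + of_real t"
  using h f_inv_into_f[of "h z + of_real t" h unit_disk]
  by (auto simp: Sigma1_def semiflow_def)

lemma inj_to_half_plane: "inj_on (to_half_plane h) right_half_plane"
proof (rule inj_onI)
  fix v w assume "v \<in> right_half_plane" "w \<in> right_half_plane" "to_half_plane h v = to_half_plane h w"
  then have pos: "Re v > 0" "Re w > 0" and eq: "h (inv_cayley v) = h (inv_cayley w)"
    by (auto simp: to_half_plane_def)
  then have "inv_cayley v = inv_cayley w"
    using h cmod_inv_cayley by (auto simp: Sigma1_def dest: inj_onD)
  moreover have "v + 1 \<noteq> 0" "w + 1 \<noteq> 0" using pos by (auto simp: complex_eq_iff)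
  ultimately show "v = w" by (metis cayley_inv_cayley)
qed

text \<open>Identifies the abstract flow of \<open>to_half_plane h\<close> with the Cayley image of
  \<open>semiflow\<close>; both are chosen preimages, so injectivity decides.\<close>

lemma inv_into_to_half_plane:
  assumes "cmod z < 1" "t \<ge> 0"
  shows "inv_into right_half_plane (to_half_plane h) (h z + of_real t) = cayley (semiflow h t z)"
proof -
  have lt: "cmod (semiflow h t z) < 1" by (rule semiflow_in_disk[OF assms])
  have "to_half_plane h (cayley (semiflow h t z)) = h z + of_real t"
    by (simp add: to_half_plane_cayley[OF lt] h_semiflow assms)
  then show ?thesis
    using inv_into_f_f[OF inj_to_half_plane, of "cayley (semiflow h t z)"] Re_cayley_pos[OF lt] by simp
qed

lemma half_plane_shift_to_half_plane: "half_plane_shift (to_half_plane h)"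
proof
  have "h \<circ> inv_cayley holomorphic_on right_half_plane"
  proof (rule holomorphic_on_compose_gen)
    show "inv_cayley holomorphic_on right_half_plane"
      unfolding inv_cayley_def[abs_def] by (intro holomorphic_intros) (auto simp: complex_eq_iff)
    show "h holomorphic_on unit_disk" using h by (simp add: Sigma1_def)
  qed (use cmod_inv_cayley in auto)
  then show "to_half_plane h holomorphic_on right_half_plane"
    by (simp add: to_half_plane_def[abs_def] o_def)
  show "inj_on (to_half_plane h) right_half_plane" by (rule inj_to_half_plane)
next
  fix w assume w: "Re w > 0"
  have z: "cmod (inv_cayley w) < 1" by (rule cmod_inv_cayley[OF w])
  show "to_half_plane h w + of_real t \<in> to_half_plane h ` right_half_plane" if "t \<ge> 0" for t
  proof
    have lt: "cmod (semiflow h t (inv_cayley w)) < 1" by (rule semiflow_in_disk[OF z that])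
    show "to_half_plane h w + of_real t = to_half_plane h (cayley (semiflow h t (inv_cayley w)))"
      by (simp add: to_half_plane_cayley[OF lt] h_semiflow[OF z that]) (simp add: to_half_plane_def)
    show "cayley (semiflow h t (inv_cayley w)) \<in> right_half_plane"
      using Re_cayley_pos[OF lt] by simp
  qed
  have lim: "((\<lambda>t. semiflow h t (inv_cayley w)) \<longlongrightarrow> 1) at_top"
    using h z by (simp add: Sigma1_def)
  have "\<forall>\<^sub>F t in at_top. semiflow h t (inv_cayley w) \<noteq> 1"
    using eventually_ge_at_top[of 0] by eventually_elim (use semiflow_in_disk[OF z] in force)
  with lim have "filterlim (\<lambda>t. semiflow h t (inv_cayley w)) (at 1) at_top"
    by (simp add: filterlim_at)
  then have "filterlim (\<lambda>t. cayley (semiflow h t (inv_cayley w))) at_infinity at_top"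
    by (rule filterlim_compose[OF filterlim_cayley])
  moreover have "\<forall>\<^sub>F t in at_top. cayley (semiflow h t (inv_cayley w))
      = inv_into right_half_plane (to_half_plane h) (to_half_plane h w + of_real t)"
    using eventually_ge_at_top[of 0]
  proof eventually_elim
    case (elim t)
    then show ?case using inv_into_to_half_plane[OF z elim] by (simp add: to_half_plane_def)
  qed
  ultimately show "filterlim (\<lambda>t. inv_into right_half_plane (to_half_plane h) (to_half_plane h w + of_real t))
      at_infinity at_top"
    by (simp add: filterlim_cong[OF refl refl])
qed

lemma horo_dist_semiflow:
  assumes "cmod z < 1" "t \<ge> 0"
  shows "horo_dist (semiflow h t z) = 1 / Re (half_plane_shift.flow (to_half_plane h) t (cayley z))"
  unfolding half_plane_shift.flow_def[OF half_plane_shift_to_half_plane] to_half_plane_cayley[OF assms(1)]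
  by (simp add: inv_into_to_half_plane[OF assms] Re_cayley)

lemma strongly_tangential_imp_limit:
  assumes z: "cmod z < 1" and st: "strongly_tangential h z"
  shows "((\<lambda>t. Re (half_plane_shift.flow (to_half_plane h) t (cayley z))) \<longlongrightarrow> 1 / orbit_eps h z) at_top"
proof -
  have "((\<lambda>t. 1 / horo_dist (semiflow h t z)) \<longlongrightarrow> 1 / orbit_eps h z) at_top"
    using st unfolding strongly_tangential_def by (intro tendsto_intros) auto
  moreover have "\<forall>\<^sub>F t in at_top. 1 / horo_dist (semiflow h t z)
      = Re (half_plane_shift.flow (to_half_plane h) t (cayley z))"
    using eventually_ge_at_top[of 0] by eventually_elim (simp add: horo_dist_semiflow[OF z])
  ultimately show ?thesis by (simp add: tendsto_cong)
qed

lemma limit_imp_strongly_tangential: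
  assumes z: "cmod z < 1" and "L > 0"
    and lim: "((\<lambda>t. Re (half_plane_shift.flow (to_half_plane h) t (cayley z))) \<longlongrightarrow> L) at_top"
  shows "strongly_tangential h z" and "orbit_eps h z = 1 / L"
proof -
  have "((\<lambda>t. 1 / Re (half_plane_shift.flow (to_half_plane h) t (cayley z))) \<longlongrightarrow> 1 / L) at_top"
    using \<open>L > 0\<close> by (intro tendsto_intros lim) auto
  moreover have "\<forall>\<^sub>F t in at_top. 1 / Re (half_plane_shift.flow (to_half_plane h) t (cayley z))
      = horo_dist (semiflow h t z)"
    using eventually_ge_at_top[of 0] by eventually_elim (simp add: horo_dist_semiflow[OF z])
  ultimately have *: "((\<lambda>t. horo_dist (semiflow h t z)) \<longlongrightarrow> 1 / L) at_top"
    by (simp add: tendsto_cong)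
  then show eps: "orbit_eps h z = 1 / L"
    unfolding orbit_eps_def by (intro tendsto_Lim) auto
  have "((\<lambda>t. semiflow h t z) \<longlongrightarrow> 1) at_top"
    using h z by (simp add: Sigma1_def)
  then show "strongly_tangential h z"
    unfolding strongly_tangential_def eps using * \<open>L > 0\<close> by simp
qed

lemma deriv_to_half_plane:
  assumes "Re w > 0"
  shows "deriv (to_half_plane h) w = deriv h (inv_cayley w) * (2 / (w + 1)\<^sup>2)"
proof (rule DERIV_imp_deriv)
  have "(h has_field_derivative deriv h (inv_cayley w)) (at (inv_cayley w))"
    using h cmod_inv_cayley[OF assms] by (intro holomorphic_derivI[of _ unit_disk]) (auto simp: Sigma1_def)
  moreover have "w + 1 \<noteq> 0" using assms by (auto simp: complex_eq_iff)
  ultimately show "(to_half_plane h has_field_derivative deriv h (inv_cayley w) * (2 / (w + 1)\<^sup>2)) (at w)"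
    unfolding to_half_plane_def[abs_def] by (intro DERIV_chain2[OF _ inv_cayley_deriv])
qed

lemma growth_to_half_plane:
  assumes lim: "((\<lambda>z. (1 - z) powr of_real (1 + \<alpha>) * deriv h z) \<longlongrightarrow> l) (at 1 within unit_disk)"
  shows "((\<lambda>w. deriv (to_half_plane h) w * ((w + 1) / 2) powr of_real (1 - \<alpha>)) \<longlongrightarrow> l / 2) half_plane_infinity"
proof -
  have "((\<lambda>w. (1 - inv_cayley w) powr of_real (1 + \<alpha>) * deriv h (inv_cayley w) / 2) \<longlongrightarrow> l / 2) half_plane_infinity"
    by (intro tendsto_divide[OF filterlim_compose[OF lim filterlim_inv_cayley] tendsto_const]) simp
  moreover have "\<forall>\<^sub>F w in half_plane_infinity. (1 - inv_cayley w) powr of_real (1 + \<alpha>) * deriv h (inv_cayley w) / 2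
      = deriv (to_half_plane h) w * ((w + 1) / 2) powr of_real (1 - \<alpha>)"
    unfolding half_plane_infinity_def eventually_inf_principal
  proof (intro always_eventually allI impI)
    fix w assume "w \<in> right_half_plane"
    then have w: "Re w > 0" by simp
    define p where "p = (w + 1) / 2"
    have "w + 1 \<noteq> 0" using w by (auto simp: complex_eq_iff)
    have "Re p > 0" using w by (simp add: p_def)
    then have p: "p \<noteq> 0" "p \<notin> \<real>\<^sub>\<le>\<^sub>0" by (auto simp: complex_nonpos_Reals_iff)
    \<comment> \<open>Off the nonpositive axis Ln (1 / p) = - Ln p, so the principal branches match;
      the exponent -(1 + \<alpha>) is (1 - \<alpha>) - 2.\<close>
    have "inverse p powr of_real (1 + \<alpha>) = p powr (of_real (1 - \<alpha>) - of_nat 2)"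
      using p by (simp add: powr_def Ln_inverse algebra_simps)
    also have "\<dots> = p powr of_real (1 - \<alpha>) / p\<^sup>2"
      using p by (simp add: powr_diff del: of_nat_numeral)
    finally show "(1 - inv_cayley w) powr of_real (1 + \<alpha>) * deriv h (inv_cayley w) / 2
      = deriv (to_half_plane h) w * ((w + 1) / 2) powr of_real (1 - \<alpha>)"
      unfolding one_minus_inv_cayley[OF \<open>w + 1 \<noteq> 0\<close>] deriv_to_half_plane[OF w] p_def[symmetric]
      by (simp add: p_def power_divide)
  qed
  ultimately show ?thesis by (simp add: tendsto_cong)
qed

end

section \<open>Both implications and the explicit bounds\<close>

theorem theorem23:
  fixes h :: "complex \<Rightarrow> complex" and \<alpha> :: real
  assumes "0 \<le> \<alpha>" and "\<alpha> \<le> 2" and "h \<in> Sigma1_pow \<alpha>"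
  shows "((\<exists>z\<in>unit_disk. strongly_tangential h z) \<longrightarrow>
            \<alpha> = 1 \<and> (\<exists>H. horizontal_half_plane H \<and> h ` unit_disk \<subseteq> H)) \<and>
         (\<alpha> = 1 \<and> (\<exists>H. horizontal_half_plane H \<and> h ` unit_disk \<subseteq> H) \<longrightarrow>
            (\<forall>z\<in>unit_disk. strongly_tangential h z) \<and>
            (\<exists>\<mu>. ((\<lambda>z. (1 - z)\<^sup>2 * deriv h z) \<longlongrightarrow> \<mu>) (at 1 within unit_disk) \<and>
               Re \<mu> = 0 \<and>
               ((Im \<mu> > 0 \<and> (\<forall>z\<in>unit_disk. Im (h z) \<ge> - Im \<mu> / (2 * orbit_eps h 0))) \<or>
                (Im \<mu> < 0 \<and> (\<forall>z\<in>unit_disk. Im (h z) \<le> - Im \<mu> / (2 * orbit_eps h 0))))))"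
proof -
  have h: "h \<in> Sigma1" using assms(3) by (simp add: Sigma1_pow_def)
  obtain l where "l \<noteq> 0"
    and l: "((\<lambda>z. (1 - z) powr of_real (1 + \<alpha>) * deriv h z) \<longlongrightarrow> l) (at 1 within unit_disk)"
    using assms(3) unfolding Sigma1_pow_def by blast
  define g where "g = to_half_plane h"
  interpret half_plane_shift_power g \<alpha> "l / 2"
    unfolding g_def half_plane_shift_power_def half_plane_shift_power_axioms_def
    using half_plane_shift_to_half_plane[OF h] growth_to_half_plane[OF h l] \<open>l \<noteq> 0\<close> by simp
  \<comment> \<open>For \<alpha> = 1 the power in \<open>growth\<close> has exponent 0 and equals
    1.\<close>
  have slope: "(deriv g \<longlongrightarrow> l / 2) half_plane_infinity" if "\<alpha> = 1"
  proof -
    have "\<forall>\<^sub>F w in half_plane_infinity. deriv g w * ((w + 1) / 2) powr of_real (1 - \<alpha>) = deriv g w"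
      unfolding half_plane_infinity_def eventually_inf_principal
      by (intro always_eventually) (auto simp: that complex_eq_iff)
    from tendsto_cong[OF this] growth show ?thesis by blast
  qed
  have g_cayley: "g (cayley z) = h z" if "cmod z < 1" for z
    unfolding g_def by (rule to_half_plane_cayley[OF that])
  note pos = Re_cayley_pos
  have A: "\<alpha> = 1 \<and> (\<exists>H. horizontal_half_plane H \<and> h ` unit_disk \<subseteq> H)"
    if "z \<in> unit_disk" and st: "strongly_tangential h z" for z
  proof -
    have z: "cmod z < 1" using that by simp
    define L where "L = 1 / orbit_eps h z"
    have L: "((\<lambda>t. Re (flow t (cayley z))) \<longlongrightarrow> L) at_top"
      using strongly_tangential_imp_limit[OF h z st] by (simp add: L_def g_def)
    note bound = Re_flow_le_limit[OF pos[OF z] L]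
    have \<alpha>: "\<alpha> = 1"
      using bounded_Re_imp_order_ge_1[OF pos[OF z] bound]
        bounded_Re_imp_order_le_1[OF pos[OF z] bound \<open>\<alpha> \<le> 2\<close>] by simp
    have Re0: "Re (l / 2) = 0"
      by (rule Re_slope_eq_0[OF pos[OF z] c slope[OF \<alpha>] bound])
    define b where "b = Im (l / 2)"
    have "b \<noteq> 0" using Re0 c by (auto simp: b_def complex_eq_iff)
    \<comment> \<open>The left side is the limit of the real part along the trajectory of
      \<open>v\<close>. The sign of \<open>b\<close> decides on which side Im h is bounded.\<close>
    have *: "L + (Im (h v) - Im (h z)) / b > 0" if "cmod v < 1" for v
      using Re_flow_limit_transfer(2)[OF pos[OF that] pos[OF z] c Re0 slope[OF \<alpha>] L]
      by (simp only: g_cayley[OF that] g_cayley[OF z] b_def)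
    have "\<exists>H. horizontal_half_plane H \<and> h ` unit_disk \<subseteq> H"
    proof (cases "b > 0")
      case True
      then have "h ` unit_disk \<subseteq> {w. Im w > Im (h z) - b * L}"
        using * by (auto simp: field_simps)
      then show ?thesis unfolding horizontal_half_plane_def by blast
    next
      case False
      with \<open>b \<noteq> 0\<close> have "h ` unit_disk \<subseteq> {w. Im w < Im (h z) - b * L}"
        using * by (auto simp: field_simps)
      then show ?thesis unfolding horizontal_half_plane_def by blast
    qed
    with \<alpha> show ?thesis by blast
  qed
  have B: "(\<forall>z\<in>unit_disk. strongly_tangential h z) \<and>
      (\<exists>\<mu>. ((\<lambda>z. (1 - z)\<^sup>2 * deriv h z) \<longlongrightarrow> \<mu>) (at 1 within unit_disk) \<and>
         Re \<mu> = 0 \<and>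
         ((Im \<mu> > 0 \<and> (\<forall>z\<in>unit_disk. Im (h z) \<ge> - Im \<mu> / (2 * orbit_eps h 0))) \<or>
          (Im \<mu> < 0 \<and> (\<forall>z\<in>unit_disk. Im (h z) \<le> - Im \<mu> / (2 * orbit_eps h 0)))))"
    if \<alpha>: "\<alpha> = 1" and H: "horizontal_half_plane H" "h ` unit_disk \<subseteq> H" for H
  proof -
    \<comment> \<open>The sign \<sigma> treats upper and lower half-planes, open or closed, at
      once.\<close>
    have "\<exists>\<sigma> C. (\<sigma> = 1 \<or> \<sigma> = (-1 :: real)) \<and> (\<forall>w\<in>H. \<sigma> * Im w \<ge> C)"
    proof -
      obtain C where "(\<forall>w\<in>H. Im w \<ge> C) \<or> (\<forall>w\<in>H. Im w \<le> C)"
        using H(1) unfolding horizontal_half_plane_def by (metis mem_Collect_eq less_imp_le)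
      then have "(\<forall>w\<in>H. 1 * Im w \<ge> C) \<or> (\<forall>w\<in>H. (-1) * Im w \<ge> - C)" by auto
      then show ?thesis by blast
    qed
    then obtain \<sigma> C where \<sigma>: "\<sigma> = 1 \<or> \<sigma> = (-1 :: real)" and C: "\<And>w. w \<in> H \<Longrightarrow> \<sigma> * Im w \<ge> C"
      by blast
    have Im_g: "\<sigma> * Im (g w) \<ge> C" if "Re w > 0" for w
      unfolding g_def to_half_plane_def using H(2) cmod_inv_cayley[OF that] by (intro C) auto
    \<comment> \<open>The base point 1 is the Cayley image of 0, where h vanishes; its limit
      \<open>L\<close> will be the reciprocal of \<open>orbit_eps h 0\<close>.\<close>
    have one: "Re 1 > 0" by simp
    obtain M where M: "\<And>t. t \<ge> 0 \<Longrightarrow> Re (flow t 1) \<le> M"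
      using Im_bound_imp_bounded_Re[OF c slope[OF \<alpha>] \<sigma> Im_g one] by blast
    obtain L where L: "((\<lambda>t. Re (flow t 1)) \<longlongrightarrow> L) at_top"
      using bounded_Re_flow_converges[OF one M] by blast
    have Re0: "Re (l / 2) = 0"
      by (rule Re_slope_eq_0[OF one c slope[OF \<alpha>] M])
    have cayley0: "cayley 0 = 1" by (simp add: cayley_def)
    have g1: "g 1 = 0"
      using g_cayley[of 0] h by (simp add: cayley0 Sigma1_def)
    have limit: "((\<lambda>t. Re (flow t (cayley z))) \<longlongrightarrow> L + Im (h z) / Im (l / 2)) at_top"
      and limit_pos: "L + Im (h z) / Im (l / 2) > 0" if "cmod z < 1" for z
      using Re_flow_limit_transfer[OF pos[OF that] one c Re0 slope[OF \<alpha>] L]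
      unfolding g_cayley[OF that] g1 by simp_all
    have "L > 0" using limit_pos[of 0] h by (simp add: Sigma1_def)
    then have eps: "orbit_eps h 0 = 1 / L"
      using limit_imp_strongly_tangential(2)[OF h, of 0 L] L by (simp add: cayley0 g_def)
    have "strongly_tangential h z" if "z \<in> unit_disk" for z
      using limit_imp_strongly_tangential(1)[OF h _ limit_pos] limit that by (simp add: g_def)
    moreover have "((\<lambda>z. (1 - z)\<^sup>2 * deriv h z) \<longlongrightarrow> l) (at 1 within unit_disk)"
    proof -
      have "\<forall>\<^sub>F z in at 1 within unit_disk. (1 - z) powr of_real (1 + \<alpha>) * deriv h z = (1 - z)\<^sup>2 * deriv h z"
        unfolding eventually_at_filter
      proof (intro always_eventually allI impI)
        fix z :: complex assume "z \<noteq> 1"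
        then have "(1 - z) powr of_nat 2 = (1 - z)\<^sup>2" by (intro powr_nat') auto
        then show "(1 - z) powr of_real (1 + \<alpha>) * deriv h z = (1 - z)\<^sup>2 * deriv h z"
          by (simp add: \<alpha>)
      qed
      from tendsto_cong[OF this] l show ?thesis by blast
    qed
    moreover have "Re l = 0" using Re0 by simp
    \<comment> \<open>Multiplying L + 2 Im (h z) / Im l > 0 by Im l / 2 gives the bound, with L = 1
      / orbit_eps h 0 and the direction set by the sign of Im l.\<close>
    moreover have "Im l > 0 \<and> (\<forall>z\<in>unit_disk. Im (h z) \<ge> - Im l / (2 * orbit_eps h 0)) \<or>
        Im l < 0 \<and> (\<forall>z\<in>unit_disk. Im (h z) \<le> - Im l / (2 * orbit_eps h 0))"
    proof (cases "Im l > 0")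
      case True
      have "Im (h z) \<ge> - Im l / (2 * orbit_eps h 0)" if "cmod z < 1" for z
        using limit_pos[OF that] True by (simp add: eps field_simps)
      with True show ?thesis by simp
    next
      case False
      moreover have "Im l \<noteq> 0" using Re0 \<open>l \<noteq> 0\<close> by (auto simp: complex_eq_iff)
      ultimately have "Im l < 0" by simp
      have "Im (h z) \<le> - Im l / (2 * orbit_eps h 0)" if "cmod z < 1" for z
        using limit_pos[OF that] \<open>Im l < 0\<close> by (simp add: eps field_simps)
      with \<open>Im l < 0\<close> show ?thesis by simp
    qed
    ultimately show ?thesis by blast
  qed
  from A B show ?thesis by blast
qed

end
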